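(* Let $A$ be a unital ring and $I$ a nonempty partially ordered set. The following assertions are equivalent: (1) $\mathrm{UT}_I(A)$ is a gr-semiprimary $I\times I$-graded ring. (2) $A$ and $I$ satisfy the following two conditions: (a) $A$ is a semiprimary ring. (b) For each $i\in I$, there exists $n_i\in\mathbb{N}$ such that $I$ contains neither chains of the form $i<k_1<k_2<\cdots<k_{n_i}$ nor chains of the form $k_1<k_2<\cdots<k_{n_i}<i$.
   Context: A unital ring $A$ is semiprimary if $A/\mathrm{rad}(A)$ is semisimple and the Jacobson radical $\mathrm{rad}(A)$ is nilpotent. For a nonempty set $I$, $\Gamma=I\times I$ is a groupoid with $(k,j)(j,i)=(k,i)$ (other products undefined), and $\Gamma_0=\{(i,i):i\in I\}$. $\mathrm{M}_I(A)$ is the ring of $I\times I$ matrices over $A$ with finitely many nonzero entries; for $I$ partially ordered, $\mathrm{UT}_I(A)$ is the subring of matrices $(a_{ij})_{ij}$ with $a_{ij}=0$ whenever $i\not\le j$. It is $\Gamma$-graded: for $R=\mathrm{UT}_I(A)$, $R_{(i,j)}=AE_{ij}$ if $i\le j$ and $R_{(i,j)}=0$ otherwise ($E_{ij}$ the elementary matrix); put $1_e=E_{ii}$ for $e=(i,i)$. A one- or two-sided ideal $U$ of $R$ is graded if $U=\bigoplus_{\gamma}(U\cap R_\gamma)$, and $R/U$ is graded by $(R/U)_\gamma=(R_\gamma+U)/U$ when $U$ is two-sided. $\mathrm{rad}^{\mathrm{gr}}(R)$ is the intersection of all gr-maximal graded right ideals of $R$ (those maximal among proper graded right ideals); it is a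 graded two-sided ideal. A nonzero graded right ideal is gr-simple if it contains no graded right ideals other than $0$ and itself; a graded ring is gr-semisimple if it is a sum of gr-simple graded right ideals. $R$ is gr-semiprimary if the graded ring $R/\mathrm{rad}^{\mathrm{gr}}(R)$ is gr-semisimple and $J=\mathrm{rad}^{\mathrm{gr}}(R)$ is objectwise nilpotent, i.e. for each $e\in\Gamma_0$ there are positive integers $n_e,m_e$ with $1_eJ^{n_e}=0$ and $J^{m_e}1_e=0$.
   Formalization: The unital ring A is assumed nonzero (1 ≠ 0); for A = 0 and I the integers, UT_I(A) = 0 is gr-semiprimary although condition (b) fails. *)

theory Defs
  imports "HOL-Algebra.QuotRing" "HOL-Algebra.Ideal_Product" "HOL-Algebra.Generated_Groups"
begin

section \<open>Rings without unit, right ideals, direct sums\<close>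

text \<open>
  The locale \<^locale>\<open>ring\<close> requires a unit, which matrix rings over an infinite index set lack.
  Such rings still live in the record type of rings; their \<^const>\<open>one\<close> field carries no meaning,
  and no definition below depends on it.
\<close>

locale nonunital_ring = abelian_group R for R (structure) +
  assumes m_closed: "\<lbrakk>x \<in> carrier R; y \<in> carrier R\<rbrakk> \<Longrightarrow> x \<otimes> y \<in> carrier R"
    and m_assoc: "\<lbrakk>x \<in> carrier R; y \<in> carrier R; z \<in> carrier R\<rbrakk> \<Longrightarrow> (x \<otimes> y) \<otimes> z = x \<otimes> (y \<otimes> z)"
    and l_distr: "\<lbrakk>x \<in> carrier R; y \<in> carrier R; z \<in> carrier R\<rbrakk> \<Longrightarrow> (x \<oplus> y) \<otimes> z = x \<otimes> z \<oplus> y \<otimes> z"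
    and r_distr: "\<lbrakk>x \<in> carrier R; y \<in> carrier R; z \<in> carrier R\<rbrakk> \<Longrightarrow> z \<otimes> (x \<oplus> y) = z \<otimes> x \<oplus> z \<otimes> y"

definition right_ideal :: "('r, 'm) ring_scheme \<Rightarrow> 'r set \<Rightarrow> bool" where
  "right_ideal R U \<longleftrightarrow>
     additive_subgroup U R \<and> (\<forall>u\<in>U. \<forall>r\<in>carrier R. u \<otimes>\<^bsub>R\<^esub> r \<in> U)"

definition sum_family :: "('r, 'm) ring_scheme \<Rightarrow> 'r set set \<Rightarrow> 'r set" where
  "sum_family R \<F> = generate (add_monoid R) (\<Union>\<F>)"

definition is_direct_sum ::
  "('r, 'm) ring_scheme \<Rightarrow> 'g set \<Rightarrow> ('g \<Rightarrow> 'r set) \<Rightarrow> 'r set \<Rightarrow> bool" where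
  "is_direct_sum R \<Gamma> F U \<longleftrightarrow>
     (\<forall>\<gamma>\<in>\<Gamma>. additive_subgroup (F \<gamma>) R) \<and>
     (\<forall>\<gamma>\<in>\<Gamma>. F \<gamma> \<inter> sum_family R (F ` (\<Gamma> - {\<gamma>})) = {\<zero>\<^bsub>R\<^esub>}) \<and>
     U = sum_family R (F ` \<Gamma>)"

text \<open>
  Since \<open>R\<^sup>2 = R\<close> may fail without a unit, \<open>J\<^sup>1\<close> is stipulated to be \<open>J\<close>
  rather than the product of \<open>J\<^sup>0 = R\<close> and \<open>J\<close>.
\<close>

fun ideal_power :: "('r, 'm) ring_scheme \<Rightarrow> 'r set \<Rightarrow> nat \<Rightarrow> 'r set" where
  "ideal_power R J 0 = carrier R"
| "ideal_power R J (Suc 0) = J"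
| "ideal_power R J (Suc (Suc n)) = ideal_prod R (ideal_power R J (Suc n)) J"


section \<open>Semiprimary rings\<close>

definition maximal_right_ideal :: "('r, 'm) ring_scheme \<Rightarrow> 'r set \<Rightarrow> bool" where
  "maximal_right_ideal R U \<longleftrightarrow>
     right_ideal R U \<and> U \<noteq> carrier R \<and>
     (\<forall>V. right_ideal R V \<and> U \<subseteq> V \<longrightarrow> V = U \<or> V = carrier R)"

definition jacobson_radical :: "('r, 'm) ring_scheme \<Rightarrow> 'r set" where
  "jacobson_radical R = carrier R \<inter> \<Inter>{U. maximal_right_ideal R U}"

definition simple_right_ideal :: "('r, 'm) ring_scheme \<Rightarrow> 'r set \<Rightarrow> bool" where
  "simple_right_ideal R S \<longleftrightarrow>
     right_ideal R S \<and> S \<noteq> {\<zero>\<^bsub>R\<^esub>} \<and>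
     (\<forall>V. right_ideal R V \<and> V \<subseteq> S \<longrightarrow> V = {\<zero>\<^bsub>R\<^esub>} \<or> V = S)"

definition semisimple_ring :: "('r, 'm) ring_scheme \<Rightarrow> bool" where
  "semisimple_ring R \<longleftrightarrow> carrier R = sum_family R {S. simple_right_ideal R S}"

definition semiprimary_ring :: "('r, 'm) ring_scheme \<Rightarrow> bool" where
  "semiprimary_ring R \<longleftrightarrow>
     semisimple_ring (R Quot jacobson_radical R) \<and>
     (\<exists>n\<ge>1. ideal_power R (jacobson_radical R) n = {\<zero>\<^bsub>R\<^esub>})"


section \<open>Graded right ideals and the graded radical\<close>

text \<open>
  A grading of \<open>R\<close> is given by its index set \<open>\<Gamma>\<close> and the family \<open>G\<close> of homogeneous components.
\<close>

definition gr_right_ideal ::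
  "('r, 'm) ring_scheme \<Rightarrow> 'g set \<Rightarrow> ('g \<Rightarrow> 'r set) \<Rightarrow> 'r set \<Rightarrow> bool" where
  "gr_right_ideal R \<Gamma> G U \<longleftrightarrow>
     right_ideal R U \<and> is_direct_sum R \<Gamma> (\<lambda>\<gamma>. U \<inter> G \<gamma>) U"

definition gr_maximal_right_ideal ::
  "('r, 'm) ring_scheme \<Rightarrow> 'g set \<Rightarrow> ('g \<Rightarrow> 'r set) \<Rightarrow> 'r set \<Rightarrow> bool" where
  "gr_maximal_right_ideal R \<Gamma> G U \<longleftrightarrow>
     gr_right_ideal R \<Gamma> G U \<and> U \<noteq> carrier R \<and>
     (\<forall>V. gr_right_ideal R \<Gamma> G V \<and> U \<subseteq> V \<longrightarrow> V = U \<or> V = carrier R)"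

definition gr_radical ::
  "('r, 'm) ring_scheme \<Rightarrow> 'g set \<Rightarrow> ('g \<Rightarrow> 'r set) \<Rightarrow> 'r set" where
  "gr_radical R \<Gamma> G = carrier R \<inter> \<Inter>{U. gr_maximal_right_ideal R \<Gamma> G U}"

definition gr_simple_right_ideal ::
  "('r, 'm) ring_scheme \<Rightarrow> 'g set \<Rightarrow> ('g \<Rightarrow> 'r set) \<Rightarrow> 'r set \<Rightarrow> bool" where
  "gr_simple_right_ideal R \<Gamma> G S \<longleftrightarrow>
     gr_right_ideal R \<Gamma> G S \<and> S \<noteq> {\<zero>\<^bsub>R\<^esub>} \<and>
     (\<forall>V. gr_right_ideal R \<Gamma> G V \<and> V \<subseteq> S \<longrightarrow> V = {\<zero>\<^bsub>R\<^esub>} \<or> V = S)"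

definition gr_semisimple ::
  "('r, 'm) ring_scheme \<Rightarrow> 'g set \<Rightarrow> ('g \<Rightarrow> 'r set) \<Rightarrow> bool" where
  "gr_semisimple R \<Gamma> G \<longleftrightarrow> carrier R = sum_family R {S. gr_simple_right_ideal R \<Gamma> G S}"

definition quotient_grading ::
  "('r, 'm) ring_scheme \<Rightarrow> ('g \<Rightarrow> 'r set) \<Rightarrow> 'r set \<Rightarrow> 'g \<Rightarrow> 'r set set" where
  "quotient_grading R G U \<gamma> = (\<lambda>x. U +>\<^bsub>R\<^esub> x) ` (G \<gamma> <+>\<^bsub>R\<^esub> U)"


section \<open>Rings graded by the groupoid \<open>I \<times> I\<close>\<close>

text \<open>
  The product \<open>(k, j) (j, i) = (k, i)\<close> is the only defined one, so components with
  non-composable degrees multiply to zero. The element \<open>u i\<close> is \<open>1\<^sub>e\<close> for the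
  identity \<open>e = (i, i)\<close> of the groupoid.
\<close>

locale pair_graded_ring = nonunital_ring R for R (structure) +
  fixes I :: "'i set" and G :: "'i \<times> 'i \<Rightarrow> 'a set" and u :: "'i \<Rightarrow> 'a"
  assumes direct_sum: "is_direct_sum R (I \<times> I) G (carrier R)"
    and mult_composable:
      "\<lbrakk>k \<in> I; j \<in> I; i \<in> I; x \<in> G (k, j); y \<in> G (j, i)\<rbrakk> \<Longrightarrow> x \<otimes> y \<in> G (k, i)"
    and mult_not_composable:
      "\<lbrakk>k \<in> I; j \<in> I; l \<in> I; i \<in> I; j \<noteq> l; x \<in> G (k, j); y \<in> G (l, i)\<rbrakk> \<Longrightarrow> x \<otimes> y = \<zero>"
    and unit_mem: "i \<in> I \<Longrightarrow> u i \<in> G (i, i)"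
    and unit_left: "\<lbrakk>i \<in> I; j \<in> I; x \<in> G (i, j)\<rbrakk> \<Longrightarrow> u i \<otimes> x = x"
    and unit_right: "\<lbrakk>i \<in> I; j \<in> I; x \<in> G (i, j)\<rbrakk> \<Longrightarrow> x \<otimes> u j = x"

definition objectwise_nilpotent ::
  "('r, 'm) ring_scheme \<Rightarrow> 'i set \<Rightarrow> ('i \<Rightarrow> 'r) \<Rightarrow> 'r set \<Rightarrow> bool" where
  "objectwise_nilpotent R I u J \<longleftrightarrow>
     (\<forall>i\<in>I. (\<exists>n\<ge>1. u i <#\<^bsub>R\<^esub> ideal_power R J n = {\<zero>\<^bsub>R\<^esub>}) \<and>
            (\<exists>m\<ge>1. ideal_power R J m #>\<^bsub>R\<^esub> u i = {\<zero>\<^bsub>R\<^esub>}))"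

definition gr_semiprimary_graded_ring ::
  "('r, 'm) ring_scheme \<Rightarrow> 'i set \<Rightarrow> ('i \<times> 'i \<Rightarrow> 'r set) \<Rightarrow> ('i \<Rightarrow> 'r) \<Rightarrow> bool" where
  "gr_semiprimary_graded_ring R I G u \<longleftrightarrow>
     pair_graded_ring R I G u \<and>
     (let J = gr_radical R (I \<times> I) G in
        gr_semisimple (R Quot J) (I \<times> I) (quotient_grading R G J) \<and>
        objectwise_nilpotent R I u J)"


section \<open>Upper triangular matrices\<close>

text \<open>
  Matrices indexed by \<open>I \<times> I\<close> are functions on the whole index type that vanish outside
  \<open>I \<times> I\<close>. As \<^const>\<open>finsum\<close> is only meaningful over finite sets, the sum defining the matrix
  product is restricted to its nonzero terms. The \<^const>\<open>one\<close> field is the identity matrix, which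
  belongs to the carrier only if \<open>I\<close> is finite (or \<open>A\<close> is trivial).
\<close>

definition matrix_ring :: "'i set \<Rightarrow> ('a, 'm) ring_scheme \<Rightarrow> ('i \<Rightarrow> 'i \<Rightarrow> 'a) ring" where
  "matrix_ring I A =
    \<lparr>carrier = {a. (\<forall>i j. a i j \<in> carrier A) \<and>
                   (\<forall>i j. \<not> (i \<in> I \<and> j \<in> I) \<longrightarrow> a i j = \<zero>\<^bsub>A\<^esub>) \<and>
                   finite {(i, j). a i j \<noteq> \<zero>\<^bsub>A\<^esub>}},
     mult = (\<lambda>a b i j. \<Oplus>\<^bsub>A\<^esub>k\<in>{k \<in> I. a i k \<otimes>\<^bsub>A\<^esub> b k j \<noteq> \<zero>\<^bsub>A\<^esub>}. a i k \<otimes>\<^bsub>A\<^esub> b k j),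
     one = (\<lambda>i j. if i \<in> I \<and> i = j then \<one>\<^bsub>A\<^esub> else \<zero>\<^bsub>A\<^esub>),
     zero = (\<lambda>i j. \<zero>\<^bsub>A\<^esub>),
     add = (\<lambda>a b i j. a i j \<oplus>\<^bsub>A\<^esub> b i j)\<rparr>"

definition UT :: "'i::order set \<Rightarrow> ('a, 'm) ring_scheme \<Rightarrow> ('i \<Rightarrow> 'i \<Rightarrow> 'a) ring" where
  "UT I A = (matrix_ring I A)
     \<lparr>carrier := {a \<in> carrier (matrix_ring I A). \<forall>i\<in>I. \<forall>j\<in>I. \<not> i \<le> j \<longrightarrow> a i j = \<zero>\<^bsub>A\<^esub>}\<rparr>"

definition single_entry :: "('a, 'm) ring_scheme \<Rightarrow> 'a \<Rightarrow> 'i \<Rightarrow> 'i \<Rightarrow> 'i \<Rightarrow> 'i \<Rightarrow> 'a" where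
  "single_entry A x i j = (\<lambda>k l. if k = i \<and> l = j then x else \<zero>\<^bsub>A\<^esub>)"

definition UT_grading :: "('a, 'm) ring_scheme \<Rightarrow> 'i::order \<times> 'i \<Rightarrow> ('i \<Rightarrow> 'i \<Rightarrow> 'a) set" where
  "UT_grading A = (\<lambda>(i, j). if i \<le> j then {single_entry A x i j | x. x \<in> carrier A}
                            else {\<lambda>k l. \<zero>\<^bsub>A\<^esub>})"

definition UT_unit :: "('a, 'm) ring_scheme \<Rightarrow> 'i \<Rightarrow> 'i \<Rightarrow> 'i \<Rightarrow> 'a" where
  "UT_unit A i = single_entry A \<one>\<^bsub>A\<^esub> i i"

end

theory Submission
  imports Defs
begin

text \<open>
  Write \<open>J\<close> for the graded radical of \<open>R = UT\<^sub>I(A)\<close>. A right ideal is graded iff it is stable under left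
  multiplication by the units \<open>1\<^sub>e\<close>. A graded right ideal containing all strictly upper triangular
  matrices is determined by its diagonal, a family of right ideals \<open>W i\<close> of \<open>A\<close>; the gr-maximal ones
  have one maximal \<open>W i\<close> and all others equal to \<open>A\<close>. Hence \<open>J\<close> consists of the matrices with diagonal
  entries in \<open>rad A\<close>, and the graded right ideals above \<open>J\<close> form the \<open>I\<close>-th power of the lattice of
  right ideals of \<open>A\<close> above \<open>rad A\<close>. Semisimplicity of a quotient is a property of this lattice, namely
  that only the top lies above all atoms, and it passes between a lattice and its powers.

  For nilpotency, entry \<open>(i, j)\<close> of an element of \<open>J\<^sup>n\<close> lies in \<open>(rad A)\<^sup>n\<^sup>-\<^sup>q\<close> if no chain from \<open>i\<close> to
  \<open>j\<close> has more than \<open>q\<close> strict steps, since every non-strict step contributes a factor from \<open>rad A\<close>.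
  Conversely \<open>J\<^sup>n\<close> contains \<open>(rad A)\<^sup>n E\<^sub>i\<^sub>i\<close>, and also \<open>E\<^sub>i\<^sub>k\<close> whenever some chain with \<open>n\<close> strict steps
  leads from \<open>i\<close> to \<open>k\<close>.
\<close>

section \<open>Quotients and semisimplicity\<close>

text \<open>Two cases matter: the empty \<open>C\<close> gives all right ideals, and taking for
  \<open>C\<close> the units 1_e, or their cosets, gives the graded ones. One argument thus treats
  both notions of semisimplicity.\<close>

definition stable_right_ideals :: "('r, 'm) ring_scheme \<Rightarrow> 'r set \<Rightarrow> 'r set set" where
  "stable_right_ideals R C = {U. right_ideal R U \<and> (\<forall>c\<in>C. \<forall>u\<in>U. c \<otimes>\<^bsub>R\<^esub> u \<in> U)}"

definition atoms_over :: "'b set set \<Rightarrow> 'b set \<Rightarrow> 'b set set" where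
  "atoms_over L b = {S \<in> L. S \<noteq> b \<and> (\<forall>V\<in>L. V \<subseteq> S \<longrightarrow> V = b \<or> V = S)}"

text \<open>Semisimplicity without sums: only inclusion is mentioned, so the property passes along
  order isomorphisms. \<open>sum_of_atoms_eq_carrier_iff\<close> links it to sums of simple right
  ideals.\<close>

definition atoms_span :: "'b set set \<Rightarrow> 'b set \<Rightarrow> 'b set \<Rightarrow> bool" where
  "atoms_span L b t \<longleftrightarrow> (\<forall>T\<in>L. (\<forall>S\<in>atoms_over L b. S \<subseteq> T) \<longrightarrow> T = t)"

lemma atoms_span_order_iso:
  assumes bij: "bij_betw h L L'"
    and mono: "\<And>U V. U \<in> L \<Longrightarrow> V \<in> L \<Longrightarrow> h U \<subseteq> h V \<longleftrightarrow> U \<subseteq> V"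
    and mem: "b \<in> L" "t \<in> L"
  shows "atoms_span L b t \<longleftrightarrow> atoms_span L' (h b) (h t)"
proof -
  have inj: "\<And>U V. U \<in> L \<Longrightarrow> V \<in> L \<Longrightarrow> h U = h V \<longleftrightarrow> U = V"
    using bij by (auto simp: bij_betw_def inj_on_def)
  have L': "L' = h ` L" using bij by (simp add: bij_betw_def)
  have "S \<in> atoms_over L b \<longleftrightarrow> h S \<in> atoms_over L' (h b)" if "S \<in> L" for S
    using that mem inj mono by (auto simp: atoms_over_def L')
  moreover have "atoms_over L' (h b) \<subseteq> h ` L" "atoms_over L b \<subseteq> L"
    by (auto simp: atoms_over_def L')
  ultimately have "atoms_over L' (h b) = h ` atoms_over L b"
    by blast
  then show ?thesis
    using mono inj mem \<open>atoms_over L b \<subseteq> L\<close> unfolding atoms_span_def L'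
    by (simp add: subset_iff)
qed

lemma (in abelian_group) add_subgroupI:
  assumes "H \<subseteq> carrier G" "\<zero> \<in> H" "\<And>x y. x \<in> H \<Longrightarrow> y \<in> H \<Longrightarrow> x \<oplus> y \<in> H"
    "\<And>x. x \<in> H \<Longrightarrow> \<ominus> x \<in> H"
  shows "additive_subgroup H G"
  using assms by (intro additive_subgroupI add.subgroupI) auto

lemma (in abelian_group) sum_family_additive_subgroup:
  assumes "\<Union>\<F> \<subseteq> carrier G" shows "additive_subgroup (sum_family G \<F>) G"
  unfolding sum_family_def using assms
  by (intro additive_subgroupI add.generate_is_subgroup) simp

text \<open>Serves as the induction principle for sums: to prove an additive property of all
  elements of a sum, let \<open>H\<close> be the set of elements that have it and check the
  summands.\<close>

lemma (in abelian_group) sum_family_minimal: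
  assumes "additive_subgroup H G" "\<And>U. U \<in> \<F> \<Longrightarrow> U \<subseteq> H" shows "sum_family G \<F> \<subseteq> H"
  unfolding sum_family_def using assms
  by (intro add.generate_subgroup_incl) (auto simp: additive_subgroup_def)

lemma sum_family_upper:
  "U \<in> \<F> \<Longrightarrow> U \<subseteq> sum_family R \<F>"
  unfolding sum_family_def by (auto intro: generate.incl)

section \<open>Right ideals and their sums in rings without unit\<close>

context nonunital_ring
begin

lemma l_null: "x \<in> carrier R \<Longrightarrow> \<zero> \<otimes> x = \<zero>"
  using l_distr[of "\<zero>" "\<zero>" x] m_closed[of "\<zero>" x] by (simp add: add.l_cancel_one')

lemma r_null: "x \<in> carrier R \<Longrightarrow> x \<otimes> \<zero> = \<zero>"
  using r_distr[of "\<zero>" "\<zero>" x] m_closed[of x "\<zero>"] by (simp add: add.l_cancel_one')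

lemma l_minus: assumes "x \<in> carrier R" "y \<in> carrier R" shows "\<ominus> x \<otimes> y = \<ominus> (x \<otimes> y)"
  using l_distr[of "\<ominus> x" x y] assms by (simp add: l_null l_neg m_closed minus_equality)

lemma uminus_zero: "\<ominus> \<zero> = \<zero>"
  by (rule minus_equality) simp_all

lemma r_minus: assumes "x \<in> carrier R" "y \<in> carrier R" shows "x \<otimes> \<ominus> y = \<ominus> (x \<otimes> y)"
  using r_distr[of "\<ominus> y" y x] assms by (simp add: r_null l_neg m_closed minus_equality)

lemma right_idealI:
  assumes "U \<subseteq> carrier R" "\<zero> \<in> U" "\<And>x y. x \<in> U \<Longrightarrow> y \<in> U \<Longrightarrow> x \<oplus> y \<in> U"
    "\<And>x. x \<in> U \<Longrightarrow> \<ominus> x \<in> U" "\<And>x r. x \<in> U \<Longrightarrow> r \<in> carrier R \<Longrightarrow> x \<otimes> r \<in> U"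
  shows "right_ideal R U"
  unfolding right_ideal_def using assms by (auto intro!: add_subgroupI)

lemma right_idealD:
  assumes "right_ideal R U"
  shows "U \<subseteq> carrier R" "\<zero> \<in> U" "\<And>x y. x \<in> U \<Longrightarrow> y \<in> U \<Longrightarrow> x \<oplus> y \<in> U"
    "\<And>x. x \<in> U \<Longrightarrow> \<ominus> x \<in> U" "\<And>x r. x \<in> U \<Longrightarrow> r \<in> carrier R \<Longrightarrow> x \<otimes> r \<in> U"
proof -
  interpret additive_subgroup U R using assms by (simp add: right_ideal_def)
  show "U \<subseteq> carrier R" "\<zero> \<in> U" "\<And>x y. x \<in> U \<Longrightarrow> y \<in> U \<Longrightarrow> x \<oplus> y \<in> U"
    "\<And>x. x \<in> U \<Longrightarrow> \<ominus> x \<in> U" by (auto intro: a_subset)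
  show "\<And>x r. x \<in> U \<Longrightarrow> r \<in> carrier R \<Longrightarrow> x \<otimes> r \<in> U" using assms by (simp add: right_ideal_def)
qed

text \<open>Multiplication by a fixed element is additive, so the elements that it maps into the sum
  form a subgroup; this subgroup contains every summand, hence the whole sum.\<close>

lemma sum_family_stable:
  assumes C: "C \<subseteq> carrier R" and F: "\<F> \<subseteq> stable_right_ideals R C"
  shows "sum_family R \<F> \<in> stable_right_ideals R C"
proof -
  have sub: "\<Union>\<F> \<subseteq> carrier R"
    using F right_idealD(1) by (fastforce simp: stable_right_ideals_def)
  interpret S: additive_subgroup "sum_family R \<F>" R
    by (rule sum_family_additive_subgroup[OF sub])
  have S: "sum_family R \<F> \<subseteq> carrier R" by (rule S.a_subset)
  have "x \<otimes> r \<in> sum_family R \<F>" if "x \<in> sum_family R \<F>" "r \<in> carrier R" for x r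
  proof -
    let ?H = "{x \<in> carrier R. x \<otimes> r \<in> sum_family R \<F>}"
    have "additive_subgroup ?H R"
      by (rule add_subgroupI) (auto simp: that l_null l_distr l_minus)
    moreover have "U \<subseteq> ?H" if "U \<in> \<F>" for U
    proof
      fix x assume x: "x \<in> U"
      have "right_ideal R U" using F \<open>U \<in> \<F>\<close> by (auto simp: stable_right_ideals_def)
      from right_idealD(5)[OF this x \<open>r \<in> carrier R\<close>]
      show "x \<in> ?H" using x sub \<open>U \<in> \<F>\<close> sum_family_upper[OF \<open>U \<in> \<F>\<close>, of R] by auto
    qed
    ultimately show ?thesis using sum_family_minimal that by blast
  qed
  moreover have "c \<otimes> x \<in> sum_family R \<F>" if "x \<in> sum_family R \<F>" "c \<in> C" for x c
  proof -
    have c: "c \<in> carrier R" using that C by auto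
    let ?H = "{x \<in> carrier R. c \<otimes> x \<in> sum_family R \<F>}"
    have "additive_subgroup ?H R"
      by (rule add_subgroupI) (auto simp: c r_null r_distr r_minus)
    moreover have "U \<subseteq> ?H" if "U \<in> \<F>" for U
    proof
      fix x assume x: "x \<in> U"
      have "c \<otimes> x \<in> U" using F \<open>U \<in> \<F>\<close> \<open>c \<in> C\<close> x by (auto simp: stable_right_ideals_def)
      then show "x \<in> ?H" using x sub \<open>U \<in> \<F>\<close> sum_family_upper[OF \<open>U \<in> \<F>\<close>, of R] by auto
    qed
    ultimately show ?thesis using sum_family_minimal that by blast
  qed
  ultimately show ?thesis
    by (simp add: stable_right_ideals_def right_ideal_def S.additive_subgroup_axioms)
qed

text \<open>The sum of the atoms is itself a stable right ideal, and it is the least subgroup above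
  all atoms. So it is the carrier iff every stable right ideal above all atoms is.\<close>

lemma sum_of_atoms_eq_carrier_iff:
  assumes "C \<subseteq> carrier R"
  shows "carrier R = sum_family R (atoms_over (stable_right_ideals R C) {\<zero>}) \<longleftrightarrow>
         atoms_span (stable_right_ideals R C) {\<zero>} (carrier R)" (is "_ = sum_family R ?F \<longleftrightarrow> _")
proof
  assume eq: "carrier R = sum_family R ?F"
  show "atoms_span (stable_right_ideals R C) {\<zero>} (carrier R)"
    unfolding atoms_span_def
  proof (intro ballI impI)
    fix T assume T: "T \<in> stable_right_ideals R C" "\<forall>S\<in>?F. S \<subseteq> T"
    then have sub: "additive_subgroup T R" by (simp add: stable_right_ideals_def right_ideal_def)
    have "sum_family R ?F \<subseteq> T" by (rule sum_family_minimal[OF sub]) (use T in blast)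
    then show "T = carrier R"
      unfolding eq[symmetric] using additive_subgroup.a_subset[OF sub] by (rule subset_antisym[rotated])
  qed
next
  assume span: "atoms_span (stable_right_ideals R C) {\<zero>} (carrier R)"
  have "?F \<subseteq> stable_right_ideals R C" by (auto simp: atoms_over_def)
  from sum_family_stable[OF assms this] span show "carrier R = sum_family R ?F"
    by (auto simp: atoms_span_def sum_family_upper)
qed

end

section \<open>Quotients by two-sided ideals and the correspondence theorem\<close>

locale two_sided_ideal = nonunital_ring R for R (structure) +
  fixes J
  assumes J_subgroup: "additive_subgroup J R"
    and J_left: "\<And>x r. x \<in> J \<Longrightarrow> r \<in> carrier R \<Longrightarrow> r \<otimes> x \<in> J"
    and J_right: "\<And>x r. x \<in> J \<Longrightarrow> r \<in> carrier R \<Longrightarrow> x \<otimes> r \<in> J"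

sublocale two_sided_ideal \<subseteq> abelian_subgroup J R
  by (rule abelian_subgroupI3[OF J_subgroup abelian_group_axioms])

context two_sided_ideal
begin

lemma coset_eq_iff:
  assumes "x \<in> carrier R" "y \<in> carrier R"
  shows "J +> x = J +> y \<longleftrightarrow> x \<oplus> \<ominus> y \<in> J"
  using assms a_rcos_module[of y x] a_rcos_self[of x] a_repr_independence'[of x y] by metis

lemma coset_eq_J_iff: "x \<in> carrier R \<Longrightarrow> J +> x = J \<longleftrightarrow> x \<in> J"
  using a_coset_join1[OF _ _ a_subgroup] a_rcos_const by metis

text \<open>\<open>rcoset_mult\<close> is a union over all pairs of representatives, so independence
  of the choice is needed: for \<open>x' = a + x\<close> and \<open>y' = b + y\<close> the
  difference \<open>x'y' - xy = ay' + xb\<close> lies in \<open>J\<close>.\<close>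

lemma coset_mult:
  assumes x: "x \<in> carrier R" and y: "y \<in> carrier R"
  shows "[mod J:] (J +> x) \<Otimes> (J +> y) = J +> (x \<otimes> y)"
proof -
  have "J +> (x' \<otimes> y') = J +> (x \<otimes> y)" if x': "x' \<in> J +> x" and y': "y' \<in> J +> y" for x' y'
  proof -
    obtain a b where ab: "a \<in> J" "b \<in> J" "x' = a \<oplus> x" "y' = b \<oplus> y"
      using x' y' by (auto simp: a_r_coset_def')
    have "x' \<otimes> y' \<oplus> \<ominus> (x \<otimes> y) = a \<otimes> y' \<oplus> x \<otimes> b"
      using ab x y
      by (simp add: l_distr r_distr m_closed a_ac r_neg)
    also have "\<dots> \<in> J" using ab x y by (intro a_closed J_left J_right) auto
    finally show ?thesis using ab x y by (subst coset_eq_iff) (auto intro!: m_closed)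
  qed
  then have "[mod J:] (J +> x) \<Otimes> (J +> y) = (\<Union>a\<in>J +> x. \<Union>b\<in>J +> y. J +> (x \<otimes> y))"
    unfolding rcoset_mult_def by (intro SUP_cong refl)
  also have "\<dots> = J +> (x \<otimes> y)"
    using a_rcos_self[OF x] a_rcos_self[OF y] by blast
  finally show ?thesis .
qed

lemma carrier_Quot: "carrier (R Quot J) = (+>) J ` carrier R"
  by (auto simp: FactRing_def A_RCOSETS_def')

lemma zero_Quot: "\<zero>\<^bsub>R Quot J\<^esub> = J"
  by (simp add: FactRing_def)

lemma add_Quot:
  "x \<in> carrier R \<Longrightarrow> y \<in> carrier R \<Longrightarrow> (J +> x) \<oplus>\<^bsub>R Quot J\<^esub> (J +> y) = J +> (x \<oplus> y)"
  by (simp add: FactRing_def a_rcos_sum)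

lemma mult_Quot:
  "x \<in> carrier R \<Longrightarrow> y \<in> carrier R \<Longrightarrow> (J +> x) \<otimes>\<^bsub>R Quot J\<^esub> (J +> y) = J +> (x \<otimes> y)"
  by (simp add: FactRing_def coset_mult)

lemma quotient_nonunital_ring: "nonunital_ring (R Quot J)"
proof (intro nonunital_ring.intro abelian_groupI nonunital_ring_axioms.intro)
  fix X assume "X \<in> carrier (R Quot J)"
  then obtain x where x: "x \<in> carrier R" "X = J +> x" by (auto simp: carrier_Quot)
  have "J +> \<zero> = J" by (rule a_coset_add_zero[OF a_subset])
  with x show "\<zero>\<^bsub>R Quot J\<^esub> \<oplus>\<^bsub>R Quot J\<^esub> X = X"
    using add_Quot[of "\<zero>" x] by (simp add: zero_Quot)
  show "\<exists>y\<in>carrier (R Quot J). y \<oplus>\<^bsub>R Quot J\<^esub> X = \<zero>\<^bsub>R Quot J\<^esub>"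
    using x \<open>J +> \<zero> = J\<close> by (intro bexI[of _ "J +> \<ominus> x"]) (auto simp: add_Quot carrier_Quot zero_Quot l_neg)
next
  have "J +> \<zero> = J" by (simp add: a_coset_add_zero[OF a_subset])
  then show "\<zero>\<^bsub>R Quot J\<^esub> \<in> carrier (R Quot J)" by (force simp: zero_Quot carrier_Quot)
qed (auto simp: carrier_Quot add_Quot mult_Quot m_closed a_ac m_assoc l_distr r_distr)

sublocale Q: nonunital_ring "R Quot J"
  by (rule quotient_nonunital_ring)

lemma uminus_Quot: "x \<in> carrier R \<Longrightarrow> \<ominus>\<^bsub>R Quot J\<^esub> (J +> x) = J +> \<ominus> x"
  using a_coset_add_zero[OF a_subset]
  by (intro Q.minus_equality) (auto simp: add_Quot carrier_Quot zero_Quot l_neg)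

definition preimage_Quot :: "'a set set \<Rightarrow> 'a set" where
  "preimage_Quot S = {x \<in> carrier R. J +> x \<in> S}"

text \<open>The correspondence theorem, with the direct image under the projection as inverse map.
  Stability under \<open>C\<close> matches stability under the cosets of \<open>C\<close> because
  cosets multiply through representatives.\<close>

lemma preimage_Quot_bij:
  assumes C: "C \<subseteq> carrier R"
  shows "bij_betw preimage_Quot (stable_right_ideals (R Quot J) ((+>) J ` C))
           {V \<in> stable_right_ideals R C. J \<subseteq> V}"
proof (intro bij_betwI[where g = "(`) ((+>) J)"] funcsetI)
  fix S assume S: "S \<in> stable_right_ideals (R Quot J) ((+>) J ` C)"
  then have S': "right_ideal (R Quot J) S" by (simp add: stable_right_ideals_def)
  note SD = Q.right_idealD[OF S']
  show "preimage_Quot S \<in> {V \<in> stable_right_ideals R C. J \<subseteq> V}"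
  proof (intro CollectI conjI)
    have "right_ideal R (preimage_Quot S)"
    proof (rule right_idealI)
      show "\<zero> \<in> preimage_Quot S"
        using SD(2) a_coset_add_zero[OF a_subset] by (simp add: preimage_Quot_def zero_Quot)
      fix x y assume "x \<in> preimage_Quot S" "y \<in> preimage_Quot S"
      then show "x \<oplus> y \<in> preimage_Quot S"
        using SD(3)[of "J +> x" "J +> y"] by (auto simp: preimage_Quot_def add_Quot)
    next
      fix x assume "x \<in> preimage_Quot S"
      then show "\<ominus> x \<in> preimage_Quot S"
        using SD(4)[of "J +> x"] by (auto simp: preimage_Quot_def uminus_Quot)
    next
      fix x r assume "x \<in> preimage_Quot S" "r \<in> carrier R"
      then show "x \<otimes> r \<in> preimage_Quot S"
        using SD(5)[of "J +> x" "J +> r"]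
        by (auto simp: preimage_Quot_def mult_Quot carrier_Quot m_closed)
    qed (auto simp: preimage_Quot_def)
    moreover have "c \<otimes> x \<in> preimage_Quot S" if "c \<in> C" "x \<in> preimage_Quot S" for c x
    proof -
      have "(J +> c) \<otimes>\<^bsub>R Quot J\<^esub> (J +> x) \<in> S"
        using S that by (auto simp: stable_right_ideals_def preimage_Quot_def)
      then show ?thesis using that C by (auto simp: preimage_Quot_def mult_Quot m_closed subset_iff)
    qed
    ultimately show "preimage_Quot S \<in> stable_right_ideals R C"
      by (simp add: stable_right_ideals_def)
    show "J \<subseteq> preimage_Quot S"
      using SD(2) by (auto simp: preimage_Quot_def zero_Quot a_rcos_const)
  qed
  show "(+>) J ` preimage_Quot S = S"
    using SD(1) by (auto simp: preimage_Quot_def carrier_Quot)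
next
  fix V assume V: "V \<in> {V \<in> stable_right_ideals R C. J \<subseteq> V}"
  then have V': "right_ideal R V" and JV: "J \<subseteq> V" by (auto simp: stable_right_ideals_def)
  note VD = right_idealD[OF V']
  have Vc: "\<And>x. x \<in> V \<Longrightarrow> x \<in> carrier R" using VD(1) by auto
  show "(+>) J ` V \<in> stable_right_ideals (R Quot J) ((+>) J ` C)"
  proof -
    have "right_ideal (R Quot J) ((+>) J ` V)"
    proof (rule Q.right_idealI)
      show "\<zero>\<^bsub>R Quot J\<^esub> \<in> (+>) J ` V"
        using VD(2) a_coset_add_zero[OF a_subset] by (force simp: zero_Quot)
    qed (use Vc VD in \<open>auto simp: carrier_Quot add_Quot uminus_Quot mult_Quot\<close>)
    moreover have "(J +> c) \<otimes>\<^bsub>R Quot J\<^esub> (J +> x) \<in> (+>) J ` V" if "c \<in> C" "x \<in> V" for c x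
      using V that C Vc by (subst mult_Quot) (auto simp: stable_right_ideals_def)
    ultimately show ?thesis by (simp add: stable_right_ideals_def)
  qed
  show "preimage_Quot ((+>) J ` V) = V"
  proof
    show "V \<subseteq> preimage_Quot ((+>) J ` V)" using Vc by (auto simp: preimage_Quot_def)
    show "preimage_Quot ((+>) J ` V) \<subseteq> V"
    proof
      fix x assume "x \<in> preimage_Quot ((+>) J ` V)"
      then obtain v where v: "x \<in> carrier R" "v \<in> V" "J +> x = J +> v"
        by (auto simp: preimage_Quot_def)
      \<comment> \<open>Here \<open>J \<subseteq> V\<close> enters: in general the preimage of the
        image of \<open>V\<close> is \<open>V + J\<close>.\<close>
      then have "x \<oplus> \<ominus> v \<in> V" using JV Vc by (auto simp: coset_eq_iff)
      from VD(3)[OF this v(2)] show "x \<in> V" using v Vc by (simp add: a_assoc l_neg)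
    qed
  qed
qed

text \<open>Under the correspondence the zero ideal of the quotient becomes \<open>J\<close> and the
  quotient itself becomes \<open>R\<close>, so semisimplicity of the quotient turns into a statement
  about right ideals of \<open>R\<close> alone.\<close>

lemma quotient_atoms_span_iff:
  assumes C: "C \<subseteq> carrier R"
  shows "carrier (R Quot J) =
           sum_family (R Quot J) (atoms_over (stable_right_ideals (R Quot J) ((+>) J ` C)) {\<zero>\<^bsub>R Quot J\<^esub>}) \<longleftrightarrow>
         atoms_span {V \<in> stable_right_ideals R C. J \<subseteq> V} J (carrier R)"
proof -
  let ?L = "stable_right_ideals (R Quot J) ((+>) J ` C)"
  have "preimage_Quot {\<zero>\<^bsub>R Quot J\<^esub>} = {x \<in> carrier R. x \<in> J}"
    unfolding preimage_Quot_def zero_Quot singleton_iff using coset_eq_J_iff by blast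
  then have bot: "preimage_Quot {\<zero>\<^bsub>R Quot J\<^esub>} = J" using a_subset by blast
  have top: "preimage_Quot (carrier (R Quot J)) = carrier R"
    by (auto simp: preimage_Quot_def carrier_Quot)
  have sub: "(+>) J ` C \<subseteq> carrier (R Quot J)" using C by (auto simp: carrier_Quot)
  have mono: "preimage_Quot U \<subseteq> preimage_Quot V \<longleftrightarrow> U \<subseteq> V" if "U \<in> ?L" "V \<in> ?L" for U V
  proof -
    have "U \<subseteq> carrier (R Quot J)"
      using that Q.right_idealD(1) by (simp add: stable_right_ideals_def)
    then show ?thesis by (auto simp: preimage_Quot_def carrier_Quot)
  qed
  have "{\<zero>\<^bsub>R Quot J\<^esub>} \<in> ?L" "carrier (R Quot J) \<in> ?L"
    using sub by (auto simp: stable_right_ideals_def Q.l_null Q.r_null Q.m_closed Q.uminus_zero intro!: Q.right_idealI)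
  from atoms_span_order_iso[OF preimage_Quot_bij[OF C] mono this] show ?thesis
    by (simp add: bot top Q.sum_of_atoms_eq_carrier_iff[OF sub])
qed

end

section \<open>Finite sums and direct sums\<close>

lemma (in abelian_monoid) finsum_swap:
  assumes "finite K" "finite L" "\<And>k l. k \<in> K \<Longrightarrow> l \<in> L \<Longrightarrow> f k l \<in> carrier G"
  shows "(\<Oplus>k\<in>K. \<Oplus>l\<in>L. f k l) = (\<Oplus>l\<in>L. \<Oplus>k\<in>K. f k l)"
  using assms(1,3)
proof (induction K rule: finite_induct)
  case empty
  then show ?case by (simp add: finsum_zero)
next
  case (insert k K)
  then have "(\<Oplus>l\<in>L. \<Oplus>k\<in>insert k K. f k l) = (\<Oplus>l\<in>L. f k l \<oplus> (\<Oplus>k\<in>K. f k l))"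
    by (intro finsum_cong') auto
  with insert show ?case by (simp add: finsum_addf Pi_def)
qed

lemma (in abelian_group) finsum_in_subgroup:
  assumes "additive_subgroup H G" "\<And>k. k \<in> K \<Longrightarrow> f k \<in> H"
  shows "finsum G f K \<in> H"
proof -
  interpret additive_subgroup H G by fact
  \<comment> \<open>Over an infinite index set the sum has the default value zero, which lies in
    \<open>H\<close>.\<close>
  show ?thesis using assms(2)
  proof (induction K rule: infinite_finite_induct)
    case (insert k K)
    then have "finsum G f (insert k K) = f k \<oplus> finsum G f K"
      by (intro finsum_insert) auto
    with insert show ?case by auto
  qed auto
qed

lemma is_direct_sum_cong:
  assumes "\<And>\<gamma>. \<gamma> \<in> \<Gamma> \<Longrightarrow> F \<gamma> = F' \<gamma>"
  shows "is_direct_sum R \<Gamma> F U \<longleftrightarrow> is_direct_sum R \<Gamma> F' U"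
proof -
  have "F ` \<Gamma> = F' ` \<Gamma>" "F ` (\<Gamma> - {\<gamma>}) = F' ` (\<Gamma> - {\<gamma>})" for \<gamma>
    using assms by (auto intro!: image_cong)
  then show ?thesis using assms by (simp add: is_direct_sum_def)
qed

lemma (in ring) nonunital_ring: "nonunital_ring R"
  by unfold_locales (auto simp: m_assoc l_distr r_distr)

section \<open>The Jacobson radical of a unital ring and powers of ideals\<close>

context ring
begin

interpretation nonunital: nonunital_ring R
  by (rule nonunital_ring)

lemma mem_jacobson_radical_iff:
  "x \<in> jacobson_radical R \<longleftrightarrow> x \<in> carrier R \<and> (\<forall>M. maximal_right_ideal R M \<longrightarrow> x \<in> M)"
  by (auto simp: jacobson_radical_def)

lemma maximal_right_idealD: "maximal_right_ideal R M \<Longrightarrow> right_ideal R M"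
  by (simp add: maximal_right_ideal_def)

lemma right_ideal_one_imp_carrier:
  assumes "right_ideal R U" "\<one> \<in> U" shows "U = carrier R"
proof
  show "carrier R \<subseteq> U"
    using nonunital.right_idealD(5)[OF assms(1,2)] by fastforce
qed (rule nonunital.right_idealD(1)[OF assms(1)])

text \<open>The set is \<open>M + bR\<close>. It is the right ideal above a maximal \<open>M\<close>
  that has to be the whole ring when \<open>b \<notin> M\<close>.\<close>

lemma sum_principal_right_ideal:
  assumes M: "right_ideal R M" and b: "b \<in> carrier R"
  shows "right_ideal R {m \<oplus> b \<otimes> r | m r. m \<in> M \<and> r \<in> carrier R}" (is "right_ideal R ?N")
proof -
  note MD = nonunital.right_idealD[OF M]
  have Mc: "m \<in> M \<Longrightarrow> m \<in> carrier R" for m using MD(1) by blast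
  show ?thesis
  proof (rule nonunital.right_idealI)
    show "?N \<subseteq> carrier R" using Mc b by auto
    have "\<zero> \<oplus> b \<otimes> \<zero> = \<zero>" using b by simp
    then show "\<zero> \<in> ?N" using MD(2) by force
  next
    fix x y assume "x \<in> ?N" "y \<in> ?N"
    then obtain m r n s where *: "x = m \<oplus> b \<otimes> r" "y = n \<oplus> b \<otimes> s"
      "m \<in> M" "n \<in> M" "r \<in> carrier R" "s \<in> carrier R" by auto
    then have "x \<oplus> y = (m \<oplus> n) \<oplus> b \<otimes> (r \<oplus> s)"
      using b Mc by (simp add: r_distr a_ac)
    then show "x \<oplus> y \<in> ?N" using * MD(3) by blast
  next
    fix x assume "x \<in> ?N"
    then obtain m r where *: "x = m \<oplus> b \<otimes> r" "m \<in> M" "r \<in> carrier R" by auto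
    then have "\<ominus> x = \<ominus> m \<oplus> b \<otimes> \<ominus> r"
      using b Mc by (simp add: minus_add r_minus)
    then show "\<ominus> x \<in> ?N" using * MD(4) by blast
  next
    fix x s assume "x \<in> ?N" and s: "s \<in> carrier R"
    then obtain m r where *: "x = m \<oplus> b \<otimes> r" "m \<in> M" "r \<in> carrier R" by auto
    then have "x \<otimes> s = m \<otimes> s \<oplus> b \<otimes> (r \<otimes> s)"
      using b s Mc by (simp add: l_distr m_assoc)
    then show "x \<otimes> s \<in> ?N" using * s MD(5) by blast
  qed
qed

text \<open>If \<open>a \<notin> M\<close>, left multiplication by \<open>a\<close> induces an isomorphism from \<open>R\<close> modulo this ideal onto
  the simple module \<open>R / M\<close>.\<close>

lemma maximal_right_ideal_residual:
  assumes M: "maximal_right_ideal R M" and a: "a \<in> carrier R" "a \<notin> M"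
  shows "maximal_right_ideal R {y \<in> carrier R. a \<otimes> y \<in> M}" (is "maximal_right_ideal R ?N")
proof -
  have M': "right_ideal R M" using M by (rule maximal_right_idealD)
  note MD = nonunital.right_idealD[OF M']
  have N: "right_ideal R ?N"
  proof (rule nonunital.right_idealI)
    show "x \<otimes> r \<in> ?N" if "x \<in> ?N" "r \<in> carrier R" for x r
      using that MD(5)[of "a \<otimes> x" r] a by (simp add: m_assoc)
  qed (use a MD in \<open>auto simp: r_distr r_minus\<close>)
  have "V = carrier R" if V: "right_ideal R V" "?N \<subseteq> V" "V \<noteq> ?N" for V
  proof -
    note VD = nonunital.right_idealD[OF V(1)]
    obtain v where v: "v \<in> V" "a \<otimes> v \<notin> M" using V(2,3) VD(1) by blast
    have vc: "v \<in> carrier R" using v(1) VD(1) by blast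
    \<comment> \<open>Since \<open>av\<close> is not in \<open>M\<close>, maximality gives
      \<open>M + avR = R\<close>. Writing \<open>a = m + avr\<close> yields
      \<open>a(1 - vr) = m\<close>, so \<open>1 - vr\<close> lies in
      \<open>?N \<subseteq> V\<close>. As \<open>vr\<close> lies in \<open>V\<close> too,
      \<open>V\<close> contains \<open>\<one>\<close>.\<close>
    let ?S = "{m \<oplus> a \<otimes> v \<otimes> r | m r. m \<in> M \<and> r \<in> carrier R}"
    have S: "right_ideal R ?S" using a vc by (intro sum_principal_right_ideal M') simp
    have sub: "M \<subseteq> ?S"
    proof
      fix m assume m: "m \<in> M"
      then have "m = m \<oplus> a \<otimes> v \<otimes> \<zero>" using MD(1) a vc by auto
      then show "m \<in> ?S" using m by blast
    qed
    have "\<zero> \<oplus> a \<otimes> v \<otimes> \<one> = a \<otimes> v" using a vc by simp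
    then have "a \<otimes> v \<in> ?S" using MD(2) by force
    with v(2) have "?S \<noteq> M" by metis
    with M S sub have "?S = carrier R" unfolding maximal_right_ideal_def by blast
    with a(1) obtain m r where mr: "a = m \<oplus> a \<otimes> v \<otimes> r" "m \<in> M" "r \<in> carrier R" by blast
    have mc: "m \<in> carrier R" using mr(2) MD(1) by blast
    have "a \<otimes> (\<one> \<oplus> \<ominus> (v \<otimes> r)) = a \<oplus> \<ominus> (a \<otimes> v \<otimes> r)"
      using a vc mr(3) by (simp add: r_distr r_minus m_assoc)
    also have "\<dots> = (m \<oplus> a \<otimes> v \<otimes> r) \<oplus> \<ominus> (a \<otimes> v \<otimes> r)" by (subst mr(1)) (rule refl)
    also have "\<dots> = m" using a vc mr(3) mc by (simp add: a_assoc r_neg)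
    finally have "a \<otimes> (\<one> \<oplus> \<ominus> (v \<otimes> r)) \<in> M" using mr(2) by simp
    then have "\<one> \<oplus> \<ominus> (v \<otimes> r) \<in> V" using V(2) vc mr(3) by auto
    then have "(\<one> \<oplus> \<ominus> (v \<otimes> r)) \<oplus> v \<otimes> r \<in> V" by (rule VD(3)[OF _ VD(5)[OF v(1) mr(3)]])
    then have "\<one> \<in> V" using vc mr(3) by (simp add: a_assoc l_neg)
    with V(1) show ?thesis by (rule right_ideal_one_imp_carrier)
  qed
  moreover have "\<one> \<notin> ?N" using a by simp
  ultimately show ?thesis unfolding maximal_right_ideal_def using N by blast
qed

text \<open>Closure under left multiplication is the point, the radical being an intersection of
  right ideals. If \<open>a \<notin> M\<close>, then \<open>x\<close> lies in the maximal right
  ideal of all \<open>y\<close> with \<open>ay \<in> M\<close>; if \<open>a \<in> M\<close>, then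
  \<open>ax \<in> M\<close> anyway.\<close>

lemma ideal_jacobson_radical: "ideal (jacobson_radical R) R" (is "ideal ?J R")
proof -
  have "right_ideal R ?J"
  proof (rule nonunital.right_idealI)
    note D = nonunital.right_idealD[OF maximal_right_idealD]
    show "\<zero> \<in> ?J" using D(2) by (simp add: mem_jacobson_radical_iff)
    show "x \<oplus> y \<in> ?J" if "x \<in> ?J" "y \<in> ?J" for x y
      using that D(3) by (simp add: mem_jacobson_radical_iff)
    show "\<ominus> x \<in> ?J" if "x \<in> ?J" for x
      using that D(4) by (simp add: mem_jacobson_radical_iff)
    show "x \<otimes> r \<in> ?J" if "x \<in> ?J" "r \<in> carrier R" for x r
      using that D(5) by (simp add: mem_jacobson_radical_iff)
  qed (auto simp: mem_jacobson_radical_iff)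
  moreover have "a \<otimes> x \<in> ?J" if x: "x \<in> ?J" and a: "a \<in> carrier R" for x a
    unfolding mem_jacobson_radical_iff
  proof (intro conjI allI impI)
    show "a \<otimes> x \<in> carrier R" using x a by (simp add: mem_jacobson_radical_iff)
    fix M assume M: "maximal_right_ideal R M"
    show "a \<otimes> x \<in> M"
    proof (cases "a \<in> M")
      case True
      then show ?thesis
        using x nonunital.right_idealD(5)[OF maximal_right_idealD[OF M]]
        by (simp add: mem_jacobson_radical_iff)
    next
      case False
      with maximal_right_ideal_residual[OF M a] x show ?thesis
        by (auto simp: mem_jacobson_radical_iff)
    qed
  qed
  ultimately show ?thesis
    by (intro idealI ring_axioms) (auto simp: right_ideal_def additive_subgroup_def)
qed

lemma ideal_two_sided_ideal:
  assumes "ideal J R" shows "two_sided_ideal R J"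
proof -
  interpret ideal J R by fact
  show ?thesis
    by (intro two_sided_ideal.intro nonunital_ring two_sided_ideal_axioms.intro)
       (auto simp: additive_subgroup_axioms I_l_closed I_r_closed)
qed

lemma semisimple_Quot_iff:
  assumes "ideal J R"
  shows "semisimple_ring (R Quot J) \<longleftrightarrow> atoms_span {V. right_ideal R V \<and> J \<subseteq> V} J (carrier R)"
proof -
  interpret two_sided_ideal R J using assms by (rule ideal_two_sided_ideal)
  \<comment> \<open>With an empty set of multipliers stability is no condition.\<close>
  have "{S. simple_right_ideal (R Quot J) S} =
      atoms_over (stable_right_ideals (R Quot J) ((+>) J ` {})) {\<zero>\<^bsub>R Quot J\<^esub>}"
    by (auto simp: simple_right_ideal_def atoms_over_def stable_right_ideals_def)
  then show ?thesis
    using quotient_atoms_span_iff[of "{}"] by (simp add: semisimple_ring_def stable_right_ideals_def)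
qed

lemma ideal_ideal_power: "ideal J R \<Longrightarrow> ideal (ideal_power R J n) R"
proof (induction n)
  case (Suc n)
  then show ?case by (cases n) (simp_all add: ideal_prod_is_ideal)
qed (simp add: oneideal)

text \<open>For \<open>n > 0\<close> the product is a generator of \<open>ideal_prod\<close>. For
  \<open>n = 0\<close> the power reached is \<open>J\<close> itself by definition, and
  \<open>J\<close> absorbs \<open>a\<close> from the left.\<close>

lemma ideal_power_mult:
  assumes "ideal J R" "a \<in> ideal_power R J n" "b \<in> J"
  shows "a \<otimes> b \<in> ideal_power R J (Suc n)"
  using assms ideal.I_l_closed[OF assms(1)] by (cases n) (auto intro: ideal_prod.prod)

end

section \<open>The grading of upper triangular matrices\<close>

locale UT_ring = ring A for A (structure) +
  fixes I :: "'i::order set"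
begin

abbreviation R where "R \<equiv> UT I A"
abbreviation E where "E \<equiv> single_entry A"

lemma mult_nonzeroD:
  assumes "a \<otimes> b \<noteq> \<zero>" "a \<in> carrier A" "b \<in> carrier A"
  shows "a \<noteq> \<zero>" "b \<noteq> \<zero>"
  using assms by auto

lemma carrier_UT:
  "x \<in> carrier R \<longleftrightarrow> (\<forall>i j. x i j \<in> carrier A) \<and> (\<forall>i j. x i j \<noteq> \<zero> \<longrightarrow> i \<in> I \<and> j \<in> I \<and> i \<le> j) \<and>
     finite {(i, j). x i j \<noteq> \<zero>}"
  unfolding UT_def matrix_ring_def by (simp, blast)

lemma zero_UT: "\<zero>\<^bsub>R\<^esub> = (\<lambda>i j. \<zero>)"
  by (simp add: UT_def matrix_ring_def)

lemma add_UT: "(x \<oplus>\<^bsub>R\<^esub> y) i j = x i j \<oplus> y i j"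
  by (simp add: UT_def matrix_ring_def)

lemma UT_entry_closed: "x \<in> carrier R \<Longrightarrow> x i j \<in> carrier A"
  by (simp add: carrier_UT)

lemma UT_entry_zero: "x \<in> carrier R \<Longrightarrow> \<not> (i \<in> I \<and> j \<in> I \<and> i \<le> j) \<Longrightarrow> x i j = \<zero>"
  by (auto simp: carrier_UT)

text \<open>One finite index set serves all rows and columns, so the sums in a matrix product can
  range over a fixed set instead of one that depends on the entry.\<close>

lemma UT_support:
  assumes "x \<in> carrier R"
  obtains K where "finite K" "\<And>i j. x i j \<noteq> \<zero> \<Longrightarrow> i \<in> K \<and> j \<in> K"
proof -
  let ?S = "{(i, j). x i j \<noteq> \<zero>}"
  have "finite ?S" using assms by (simp add: carrier_UT)
  then have "finite (fst ` ?S \<union> snd ` ?S)" by simp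
  moreover have "i \<in> fst ` ?S \<union> snd ` ?S \<and> j \<in> fst ` ?S \<union> snd ` ?S" if "x i j \<noteq> \<zero>" for i j
    using that by force
  ultimately show thesis using that by blast
qed

lemma mult_UT:
  assumes "x \<in> carrier R" "y \<in> carrier R" "finite K" "\<And>k. x i k \<otimes> y k j \<noteq> \<zero> \<Longrightarrow> k \<in> K"
  shows "(x \<otimes>\<^bsub>R\<^esub> y) i j = (\<Oplus>k\<in>K. x i k \<otimes> y k j)"
proof -
  have "(x \<otimes>\<^bsub>R\<^esub> y) i j = (\<Oplus>k\<in>{k \<in> I. x i k \<otimes> y k j \<noteq> \<zero>}. x i k \<otimes> y k j)"
    by (simp add: UT_def matrix_ring_def)
  also have "\<dots> = (\<Oplus>k\<in>K. x i k \<otimes> y k j)"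
  proof (rule add.finprod_mono_neutral_cong_left)
    \<comment> \<open>An index of \<open>K\<close> outside \<open>I\<close> contributes nothing,
      because \<open>x\<close> vanishes in that column.\<close>
    show "x i k \<otimes> y k j = \<zero>" if "k \<in> K - {k \<in> I. x i k \<otimes> y k j \<noteq> \<zero>}" for k
      using that assms(1,2) UT_entry_zero[of x i k] UT_entry_closed[of y] by auto
  qed (use assms UT_entry_closed in auto)
  finally show ?thesis .
qed

lemma mult_UT_left_support:
  assumes "x \<in> carrier R" "y \<in> carrier R" "finite K" "\<And>k. x i k \<noteq> \<zero> \<Longrightarrow> k \<in> K"
  shows "(x \<otimes>\<^bsub>R\<^esub> y) i j = (\<Oplus>k\<in>K. x i k \<otimes> y k j)"
proof (rule mult_UT[OF assms(1-3)])
  fix k assume "x i k \<otimes> y k j \<noteq> \<zero>"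
  from mult_nonzeroD(1)[OF this] show "k \<in> K" using assms by (simp add: UT_entry_closed)
qed

lemma mult_UT_right_support:
  assumes "x \<in> carrier R" "y \<in> carrier R" "finite K" "\<And>k. y k j \<noteq> \<zero> \<Longrightarrow> k \<in> K"
  shows "(x \<otimes>\<^bsub>R\<^esub> y) i j = (\<Oplus>k\<in>K. x i k \<otimes> y k j)"
proof (rule mult_UT[OF assms(1-3)])
  fix k assume "x i k \<otimes> y k j \<noteq> \<zero>"
  from mult_nonzeroD(2)[OF this] show "k \<in> K" using assms by (simp add: UT_entry_closed)
qed

text \<open>Reduces the support of a product to those of its factors; the triangular shape of
  products then follows from transitivity of the order.\<close>

lemma mult_UT_nonzero:
  assumes "x \<in> carrier R" "y \<in> carrier R" "(x \<otimes>\<^bsub>R\<^esub> y) i j \<noteq> \<zero>"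
  obtains k where "x i k \<noteq> \<zero>" "y k j \<noteq> \<zero>"
proof -
  obtain K where K: "finite K" "\<And>i j. x i j \<noteq> \<zero> \<Longrightarrow> i \<in> K \<and> j \<in> K"
    using UT_support[OF assms(1)] by blast
  have "(x \<otimes>\<^bsub>R\<^esub> y) i j = (\<Oplus>k\<in>K. x i k \<otimes> y k j)"
    using K(2) by (intro mult_UT_left_support assms K(1)) auto
  then have "\<not> (\<forall>k\<in>K. x i k \<otimes> y k j = \<zero>)"
    using assms(3) add.finprod_one_eqI[of K "\<lambda>k. x i k \<otimes> y k j"] by auto
  then obtain k where "x i k \<otimes> y k j \<noteq> \<zero>" by blast
  from mult_nonzeroD[OF this] show thesis using that[of k] assms by (simp add: UT_entry_closed)
qed

lemma add_UT_closed:
  assumes "x \<in> carrier R" "y \<in> carrier R" shows "x \<oplus>\<^bsub>R\<^esub> y \<in> carrier R"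
proof -
  have nz: "x i j \<noteq> \<zero> \<or> y i j \<noteq> \<zero>" if "(x \<oplus>\<^bsub>R\<^esub> y) i j \<noteq> \<zero>" for i j
    using that by (auto simp: add_UT)
  then have "{(i, j). (x \<oplus>\<^bsub>R\<^esub> y) i j \<noteq> \<zero>} \<subseteq> {(i, j). x i j \<noteq> \<zero>} \<union> {(i, j). y i j \<noteq> \<zero>}"
    by auto
  then have "finite {(i, j). (x \<oplus>\<^bsub>R\<^esub> y) i j \<noteq> \<zero>}"
    using assms by (auto simp: carrier_UT intro: finite_subset)
  then show ?thesis using assms nz unfolding carrier_UT by (metis add_UT add.m_closed)
qed

lemma mult_UT_closed:
  assumes "x \<in> carrier R" "y \<in> carrier R" shows "x \<otimes>\<^bsub>R\<^esub> y \<in> carrier R"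
proof -
  obtain K where K: "finite K" "\<And>i j. x i j \<noteq> \<zero> \<Longrightarrow> i \<in> K \<and> j \<in> K"
    using UT_support[OF assms(1)] by blast
  obtain L where L: "finite L" "\<And>i j. y i j \<noteq> \<zero> \<Longrightarrow> i \<in> L \<and> j \<in> L"
    using UT_support[OF assms(2)] by blast
  have "{(i, j). (x \<otimes>\<^bsub>R\<^esub> y) i j \<noteq> \<zero>} \<subseteq> K \<times> L"
    using K(2) L(2) mult_UT_nonzero[OF assms] by (auto; metis)
  then have "finite {(i, j). (x \<otimes>\<^bsub>R\<^esub> y) i j \<noteq> \<zero>}"
    using K(1) L(1) finite_subset by blast
  moreover have "i \<in> I \<and> j \<in> I \<and> i \<le> j" if "(x \<otimes>\<^bsub>R\<^esub> y) i j \<noteq> \<zero>" for i j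
    using mult_UT_nonzero[OF assms that] assms unfolding carrier_UT by (metis order_trans)
  moreover have "(x \<otimes>\<^bsub>R\<^esub> y) i j \<in> carrier A" for i j
  proof -
    have "(x \<otimes>\<^bsub>R\<^esub> y) i j = (\<Oplus>k\<in>K. x i k \<otimes> y k j)"
      using K(2) by (intro mult_UT_left_support assms K(1)) auto
    then show ?thesis using assms by (auto simp: UT_entry_closed)
  qed
  ultimately show ?thesis by (simp add: carrier_UT)
qed

text \<open>The support of \<open>x\<close> bounds the index \<open>k\<close> and that of
  \<open>z\<close> the index \<open>l\<close>. Both sides become double sums over the same finite
  \<open>K\<close> and \<open>L\<close>, in opposite order.\<close>

lemma mult_UT_assoc:
  assumes "x \<in> carrier R" "y \<in> carrier R" "z \<in> carrier R"
  shows "(x \<otimes>\<^bsub>R\<^esub> y) \<otimes>\<^bsub>R\<^esub> z = x \<otimes>\<^bsub>R\<^esub> (y \<otimes>\<^bsub>R\<^esub> z)"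
proof (intro ext)
  fix i j
  obtain K where K: "finite K" "\<And>i j. x i j \<noteq> \<zero> \<Longrightarrow> i \<in> K \<and> j \<in> K"
    using UT_support[OF assms(1)] by blast
  obtain L where L: "finite L" "\<And>i j. z i j \<noteq> \<zero> \<Longrightarrow> i \<in> L \<and> j \<in> L"
    using UT_support[OF assms(3)] by blast
  note [simp] = UT_entry_closed[OF assms(1)] UT_entry_closed[OF assms(2)] UT_entry_closed[OF assms(3)]
  have in_K: "x i k \<noteq> \<zero> \<Longrightarrow> k \<in> K" and in_L: "z k j \<noteq> \<zero> \<Longrightarrow> k \<in> L" for k
    using K(2) L(2) by blast+
  have "((x \<otimes>\<^bsub>R\<^esub> y) \<otimes>\<^bsub>R\<^esub> z) i j = (\<Oplus>l\<in>L. (x \<otimes>\<^bsub>R\<^esub> y) i l \<otimes> z l j)"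
    using assms L(1) in_L by (intro mult_UT_right_support mult_UT_closed)
  also have "\<dots> = (\<Oplus>l\<in>L. \<Oplus>k\<in>K. x i k \<otimes> y k l \<otimes> z l j)"
  proof (intro finsum_cong')
    fix l assume "l \<in> L"
    have "(x \<otimes>\<^bsub>R\<^esub> y) i l = (\<Oplus>k\<in>K. x i k \<otimes> y k l)"
      using assms K(1) in_K by (intro mult_UT_left_support)
    then show "(x \<otimes>\<^bsub>R\<^esub> y) i l \<otimes> z l j = (\<Oplus>k\<in>K. x i k \<otimes> y k l \<otimes> z l j)"
      using K(1) by (simp add: finsum_ldistr)
  qed auto
  also have "\<dots> = (\<Oplus>k\<in>K. \<Oplus>l\<in>L. x i k \<otimes> y k l \<otimes> z l j)"
    using K(1) L(1) by (intro finsum_swap) auto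
  also have "\<dots> = (\<Oplus>k\<in>K. x i k \<otimes> (y \<otimes>\<^bsub>R\<^esub> z) k j)"
  proof (intro finsum_cong')
    fix k assume "k \<in> K"
    have "(y \<otimes>\<^bsub>R\<^esub> z) k j = (\<Oplus>l\<in>L. y k l \<otimes> z l j)"
      using assms L(1) in_L by (intro mult_UT_right_support)
    then show "(\<Oplus>l\<in>L. x i k \<otimes> y k l \<otimes> z l j) = x i k \<otimes> (y \<otimes>\<^bsub>R\<^esub> z) k j"
      using L(1) by (simp add: finsum_rdistr m_assoc)
  qed (use assms in \<open>auto simp: UT_entry_closed mult_UT_closed\<close>)
  also have "\<dots> = (x \<otimes>\<^bsub>R\<^esub> (y \<otimes>\<^bsub>R\<^esub> z)) i j"
    using assms K(1) in_K by (intro mult_UT_left_support[symmetric] mult_UT_closed)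
  finally show "((x \<otimes>\<^bsub>R\<^esub> y) \<otimes>\<^bsub>R\<^esub> z) i j = (x \<otimes>\<^bsub>R\<^esub> (y \<otimes>\<^bsub>R\<^esub> z)) i j" .
qed

lemma UT_nonunital_ring: "nonunital_ring R"
proof (intro nonunital_ring.intro abelian_groupI nonunital_ring_axioms.intro)
  fix x assume x: "x \<in> carrier R"
  have "(\<lambda>i j. \<ominus> x i j) \<in> carrier R"
    using x by (auto simp: carrier_UT)
  moreover have "(\<lambda>i j. \<ominus> x i j) \<oplus>\<^bsub>R\<^esub> x = \<zero>\<^bsub>R\<^esub>"
    using x by (auto simp: fun_eq_iff add_UT zero_UT l_neg UT_entry_closed)
  ultimately show "\<exists>y\<in>carrier R. y \<oplus>\<^bsub>R\<^esub> x = \<zero>\<^bsub>R\<^esub>" by blast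
next
  fix x y z assume "x \<in> carrier R" "y \<in> carrier R" "z \<in> carrier R"
  note xyz = this
  note [simp] = UT_entry_closed[OF xyz(1)] UT_entry_closed[OF xyz(2)] UT_entry_closed[OF xyz(3)]
  \<comment> \<open>The common factor \<open>z\<close> supplies one finite index set for all sums in
    both distributive laws.\<close>
  obtain K where K: "finite K" "\<And>i j. z i j \<noteq> \<zero> \<Longrightarrow> i \<in> K \<and> j \<in> K"
    using UT_support[OF xyz(3)] by blast
  show "(x \<oplus>\<^bsub>R\<^esub> y) \<otimes>\<^bsub>R\<^esub> z = x \<otimes>\<^bsub>R\<^esub> z \<oplus>\<^bsub>R\<^esub> y \<otimes>\<^bsub>R\<^esub> z"
  proof (intro ext)
    fix i j
    have in_K: "z k j \<noteq> \<zero> \<Longrightarrow> k \<in> K" for k using K(2) by blast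
    have "((x \<oplus>\<^bsub>R\<^esub> y) \<otimes>\<^bsub>R\<^esub> z) i j = (\<Oplus>k\<in>K. (x \<oplus>\<^bsub>R\<^esub> y) i k \<otimes> z k j)"
      using xyz K(1) in_K by (intro mult_UT_right_support add_UT_closed)
    also have "\<dots> = (\<Oplus>k\<in>K. x i k \<otimes> z k j \<oplus> y i k \<otimes> z k j)"
      by (intro finsum_cong') (auto simp: add_UT l_distr)
    also have "\<dots> = (x \<otimes>\<^bsub>R\<^esub> z) i j \<oplus> (y \<otimes>\<^bsub>R\<^esub> z) i j"
      using xyz K(1) in_K by (simp add: mult_UT_right_support[of _ _ K] finsum_addf Pi_def)
    finally show "((x \<oplus>\<^bsub>R\<^esub> y) \<otimes>\<^bsub>R\<^esub> z) i j = (x \<otimes>\<^bsub>R\<^esub> z \<oplus>\<^bsub>R\<^esub> y \<otimes>\<^bsub>R\<^esub> z) i j"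
      by (simp add: add_UT)
  qed
  show "z \<otimes>\<^bsub>R\<^esub> (x \<oplus>\<^bsub>R\<^esub> y) = z \<otimes>\<^bsub>R\<^esub> x \<oplus>\<^bsub>R\<^esub> z \<otimes>\<^bsub>R\<^esub> y"
  proof (intro ext)
    fix i j
    have in_K: "z i k \<noteq> \<zero> \<Longrightarrow> k \<in> K" for k using K(2) by blast
    have "(z \<otimes>\<^bsub>R\<^esub> (x \<oplus>\<^bsub>R\<^esub> y)) i j = (\<Oplus>k\<in>K. z i k \<otimes> (x \<oplus>\<^bsub>R\<^esub> y) k j)"
      using xyz K(1) in_K by (intro mult_UT_left_support add_UT_closed)
    also have "\<dots> = (\<Oplus>k\<in>K. z i k \<otimes> x k j \<oplus> z i k \<otimes> y k j)"
      by (intro finsum_cong') (auto simp: add_UT r_distr)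
    also have "\<dots> = (z \<otimes>\<^bsub>R\<^esub> x) i j \<oplus> (z \<otimes>\<^bsub>R\<^esub> y) i j"
      using xyz K(1) in_K by (simp add: mult_UT_left_support[of _ _ K] finsum_addf Pi_def)
    finally show "(z \<otimes>\<^bsub>R\<^esub> (x \<oplus>\<^bsub>R\<^esub> y)) i j = (z \<otimes>\<^bsub>R\<^esub> x \<oplus>\<^bsub>R\<^esub> z \<otimes>\<^bsub>R\<^esub> y) i j"
      by (simp add: add_UT)
  qed
qed (auto simp: add_UT_closed mult_UT_closed mult_UT_assoc zero_UT fun_eq_iff add_UT UT_entry_closed a_ac
      carrier_UT[of "\<lambda>i j. \<zero>"])

sublocale UT: nonunital_ring R
  by (rule UT_nonunital_ring)

lemma uminus_UT: "x \<in> carrier R \<Longrightarrow> (\<ominus>\<^bsub>R\<^esub> x) i j = \<ominus> x i j"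
  using UT.l_neg[of x] add_UT[of "\<ominus>\<^bsub>R\<^esub> x" x i j]
  by (metis UT_entry_closed UT.a_inv_closed minus_equality zero_UT)

section \<open>Elementary matrices and diagonal entries\<close>

lemma single_entry_apply: "E a i j k l = (if k = i \<and> l = j then a else \<zero>)"
  by (simp add: single_entry_def)

lemma single_entry_closed:
  "a \<in> carrier A \<Longrightarrow> i \<in> I \<Longrightarrow> j \<in> I \<Longrightarrow> i \<le> j \<Longrightarrow> E a i j \<in> carrier R"
proof -
  assume *: "a \<in> carrier A" "i \<in> I" "j \<in> I" "i \<le> j"
  have "{(k, l). E a i j k l \<noteq> \<zero>} \<subseteq> {(i, j)}" by (auto simp: single_entry_apply split: if_splits)
  then have "finite {(k, l). E a i j k l \<noteq> \<zero>}" by (rule finite_subset) simp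
  then show ?thesis using * unfolding carrier_UT by (simp add: single_entry_apply)
qed

lemma single_entry_zero: "E \<zero> i j = \<zero>\<^bsub>R\<^esub>"
  by (auto simp: fun_eq_iff single_entry_apply zero_UT)

lemma single_entry_add:
  "a \<in> carrier A \<Longrightarrow> b \<in> carrier A \<Longrightarrow> E a i j \<oplus>\<^bsub>R\<^esub> E b i j = E (a \<oplus> b) i j"
  by (auto simp: fun_eq_iff single_entry_apply add_UT)

lemma single_entry_uminus:
  "a \<in> carrier A \<Longrightarrow> i \<in> I \<Longrightarrow> j \<in> I \<Longrightarrow> i \<le> j \<Longrightarrow> \<ominus>\<^bsub>R\<^esub> E a i j = E (\<ominus> a) i j"
  by (auto simp: fun_eq_iff single_entry_apply uminus_UT single_entry_closed)

lemma single_entry_mult_left: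
  assumes "a \<in> carrier A" "i \<in> I" "j \<in> I" "i \<le> j" "y \<in> carrier R"
  shows "E a i j \<otimes>\<^bsub>R\<^esub> y = (\<lambda>k l. if k = i then a \<otimes> y j l else \<zero>)"
proof (intro ext)
  fix k l
  have "(E a i j \<otimes>\<^bsub>R\<^esub> y) k l = (\<Oplus>m\<in>{j}. E a i j k m \<otimes> y m l)"
    using assms UT_entry_closed[of y]
    by (intro mult_UT single_entry_closed) (auto simp: single_entry_apply split: if_splits)
  then show "(E a i j \<otimes>\<^bsub>R\<^esub> y) k l = (if k = i then a \<otimes> y j l else \<zero>)"
    using assms by (simp add: single_entry_apply UT_entry_closed)
qed

lemma single_entry_mult_right:
  assumes "a \<in> carrier A" "i \<in> I" "j \<in> I" "i \<le> j" "y \<in> carrier R"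
  shows "y \<otimes>\<^bsub>R\<^esub> E a i j = (\<lambda>k l. if l = j then y k i \<otimes> a else \<zero>)"
proof (intro ext)
  fix k l
  have "(y \<otimes>\<^bsub>R\<^esub> E a i j) k l = (\<Oplus>m\<in>{i}. y k m \<otimes> E a i j m l)"
    using assms UT_entry_closed[of y]
    by (intro mult_UT single_entry_closed) (auto simp: single_entry_apply split: if_splits)
  then show "(y \<otimes>\<^bsub>R\<^esub> E a i j) k l = (if l = j then y k i \<otimes> a else \<zero>)"
    using assms by (simp add: single_entry_apply UT_entry_closed)
qed

lemma single_entry_mult:
  assumes "a \<in> carrier A" "i \<in> I" "j \<in> I" "i \<le> j" "b \<in> carrier A" "k \<in> I" "l \<in> I" "k \<le> l"
  shows "E a i j \<otimes>\<^bsub>R\<^esub> E b k l = (if j = k then E (a \<otimes> b) i l else \<zero>\<^bsub>R\<^esub>)"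
  using assms
  by (auto simp: fun_eq_iff single_entry_mult_left single_entry_closed zero_UT)
     (auto simp: single_entry_apply)

text \<open>A nonzero term at \<open>k\<close> needs \<open>i \<le> k \<le> i\<close>, so
  antisymmetry leaves only \<open>k = i\<close>. Hence requiring the diagonal entries to lie in
  right ideals of \<open>A\<close> defines a right ideal of \<open>R\<close>.\<close>

lemma diagonal_mult:
  assumes "x \<in> carrier R" "y \<in> carrier R"
  shows "(x \<otimes>\<^bsub>R\<^esub> y) i i = x i i \<otimes> y i i"
proof -
  have "(x \<otimes>\<^bsub>R\<^esub> y) i i = (\<Oplus>k\<in>{i}. x i k \<otimes> y k i)"
  proof (intro mult_UT assms)
    fix k assume "x i k \<otimes> y k i \<noteq> \<zero>"
    then have "x i k \<noteq> \<zero>" "y k i \<noteq> \<zero>" using assms mult_nonzeroD[of "x i k" "y k i"] by (auto simp: UT_entry_closed)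
    then have "i \<le> k" "k \<le> i" using assms by (auto simp: carrier_UT)
    then show "k \<in> {i}" by simp
  qed simp
  then show ?thesis using assms by (simp add: UT_entry_closed)
qed

lemma UT_unit_closed: "i \<in> I \<Longrightarrow> UT_unit A i \<in> carrier R"
  by (simp add: UT_unit_def single_entry_closed)

lemma UT_unit_mult_left:
  "i \<in> I \<Longrightarrow> x \<in> carrier R \<Longrightarrow> UT_unit A i \<otimes>\<^bsub>R\<^esub> x = (\<lambda>k l. if k = i then x k l else \<zero>)"
  by (auto simp: UT_unit_def single_entry_mult_left fun_eq_iff UT_entry_closed)

lemma UT_unit_mult_right:
  "i \<in> I \<Longrightarrow> x \<in> carrier R \<Longrightarrow> x \<otimes>\<^bsub>R\<^esub> UT_unit A i = (\<lambda>k l. if l = i then x k l else \<zero>)"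
  by (auto simp: UT_unit_def single_entry_mult_right fun_eq_iff UT_entry_closed)

text \<open>Cutting with units isolates a single entry; this is how stability under the units gives
  access to the homogeneous parts of an element.\<close>

lemma UT_unit_sandwich:
  assumes "i \<in> I" "j \<in> I" "x \<in> carrier R"
  shows "UT_unit A i \<otimes>\<^bsub>R\<^esub> x \<otimes>\<^bsub>R\<^esub> UT_unit A j = E (x i j) i j"
proof -
  have "UT_unit A i \<otimes>\<^bsub>R\<^esub> x \<in> carrier R" using assms by (simp add: UT_unit_closed UT.m_closed)
  from UT_unit_mult_right[OF assms(2) this] show ?thesis
    using assms by (auto simp: UT_unit_mult_left fun_eq_iff single_entry_apply)
qed

text \<open>A matrix with finite support is the sum of its single-entry parts. The induction runs
  over a finite set \<open>S\<close> containing the support and erases one position at a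
  time.\<close>

lemma UT_mem_subgroupI:
  assumes H: "additive_subgroup H R" and x: "x \<in> carrier R"
    and entries: "\<And>i j. i \<in> I \<Longrightarrow> j \<in> I \<Longrightarrow> E (x i j) i j \<in> H"
  shows "x \<in> H"
proof -
  interpret H: additive_subgroup H R by fact
  have "y \<in> H" if "finite S" "y \<in> carrier R" "\<And>i j. i \<in> I \<Longrightarrow> j \<in> I \<Longrightarrow> E (y i j) i j \<in> H"
      "{(i, j). y i j \<noteq> \<zero>} \<subseteq> S" for S y
    using that
  proof (induction S arbitrary: y rule: finite_induct)
    case empty
    then have "y = \<zero>\<^bsub>R\<^esub>" by (auto simp: zero_UT fun_eq_iff)
    then show ?case by simp
  next
    case (insert p S)
    obtain i j where p: "p = (i, j)" by (cases p)
    show ?case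
    proof (cases "y i j = \<zero>")
      case True
      then have "{(i, j). y i j \<noteq> \<zero>} \<subseteq> S" using insert.prems(3) p by auto
      with insert.IH[OF insert.prems(1,2)] show ?thesis by blast
    next
      case False
      then have ij: "i \<in> I" "j \<in> I" "i \<le> j" using insert.prems(1) by (auto simp: carrier_UT)
      let ?z = "\<lambda>k l. if k = i \<and> l = j then \<zero> else y k l"
      have "finite {(k, l). ?z k l \<noteq> \<zero>}"
        using insert.prems(3) insert.hyps(1) by (auto intro: finite_subset)
      then have z: "?z \<in> carrier R"
        using insert.prems(1) by (auto simp: carrier_UT)
      have z_mem: "?z \<in> H"
      proof (rule insert.IH[OF z])
        show "E (?z k l) k l \<in> H" if "k \<in> I" "l \<in> I" for k l
          using insert.prems(2)[OF that] by (auto simp: single_entry_zero)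
        show "{(k, l). ?z k l \<noteq> \<zero>} \<subseteq> S"
          using insert.prems(3) p by auto
      qed
      have "?z \<oplus>\<^bsub>R\<^esub> E (y i j) i j = y"
        using insert.prems(1) by (auto simp: fun_eq_iff add_UT single_entry_apply UT_entry_closed)
      with H.a_closed[OF z_mem insert.prems(2)[OF ij(1,2)]] show ?thesis by simp
    qed
  qed
  then show ?thesis using x entries by (auto simp: carrier_UT)
qed

section \<open>Homogeneous components and graded right ideals\<close>

lemma UT_grading_apply:
  "UT_grading A (i, j) = (if i \<le> j then {E a i j | a. a \<in> carrier A} else {\<zero>\<^bsub>R\<^esub>})"
  by (simp add: UT_grading_def zero_UT)

lemma UT_grading_subset: "i \<in> I \<Longrightarrow> j \<in> I \<Longrightarrow> UT_grading A (i, j) \<subseteq> carrier R"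
  by (auto simp: UT_grading_apply single_entry_closed)

text \<open>One criterion for both cases of the grading: if \<open>i \<le> j\<close> fails, the
  entry at \<open>(i, j)\<close> is zero, and \<open>E\<close> of zero is the zero matrix.\<close>

lemma UT_grading_mem_iff:
  assumes "i \<in> I" "j \<in> I" "x \<in> carrier R"
  shows "x \<in> UT_grading A (i, j) \<longleftrightarrow> x = E (x i j) i j"
proof
  assume "x \<in> UT_grading A (i, j)"
  then show "x = E (x i j) i j"
    by (auto simp: UT_grading_apply single_entry_zero zero_UT single_entry_apply split: if_splits)
next
  assume *: "x = E (x i j) i j"
  show "x \<in> UT_grading A (i, j)"
  proof (cases "i \<le> j")
    case True
    then show ?thesis using * assms UT_entry_closed by (auto simp: UT_grading_apply)
  next
    case False
    then have "x i j = \<zero>" using assms UT_entry_zero by blast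
    then show ?thesis using * False by (simp add: UT_grading_apply single_entry_zero)
  qed
qed

lemma UT_unit_mult_grading:
  assumes "i \<in> I" "k \<in> I" "l \<in> I" "x \<in> UT_grading A (k, l)"
  shows "UT_unit A i \<otimes>\<^bsub>R\<^esub> x = (if i = k then x else \<zero>\<^bsub>R\<^esub>)"
    and "x \<otimes>\<^bsub>R\<^esub> UT_unit A i = (if i = l then x else \<zero>\<^bsub>R\<^esub>)"
proof -
  have x: "x \<in> carrier R" "x = E (x k l) k l"
    using assms UT_grading_subset UT_grading_mem_iff[of k l x] by blast+
  have *: "x m n = \<zero>" if "\<not> (m = k \<and> n = l)" for m n
    using fun_cong[OF fun_cong[OF x(2)], of m n] that by (simp add: single_entry_apply)
  show "UT_unit A i \<otimes>\<^bsub>R\<^esub> x = (if i = k then x else \<zero>\<^bsub>R\<^esub>)"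
    using * by (auto simp: UT_unit_mult_left[OF assms(1) x(1)] fun_eq_iff zero_UT)
  show "x \<otimes>\<^bsub>R\<^esub> UT_unit A i = (if i = l then x else \<zero>\<^bsub>R\<^esub>)"
    using * by (auto simp: UT_unit_mult_right[OF assms(1) x(1)] fun_eq_iff zero_UT)
qed

lemma UT_grading_subgroup:
  assumes "i \<in> I" "j \<in> I" shows "additive_subgroup (UT_grading A (i, j)) R"
proof (rule UT.add_subgroupI)
  show "UT_grading A (i, j) \<subseteq> carrier R" by (rule UT_grading_subset[OF assms])
  show "\<zero>\<^bsub>R\<^esub> \<in> UT_grading A (i, j)"
    using single_entry_zero[of i j] by (auto simp: UT_grading_apply) (metis zero_closed)
  show "x \<oplus>\<^bsub>R\<^esub> y \<in> UT_grading A (i, j)"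
    if "x \<in> UT_grading A (i, j)" "y \<in> UT_grading A (i, j)" for x y
    using that by (auto simp: UT_grading_apply single_entry_add split: if_splits)
  show "\<ominus>\<^bsub>R\<^esub> x \<in> UT_grading A (i, j)" if "x \<in> UT_grading A (i, j)" for x
    using that assms by (auto simp: UT_grading_apply single_entry_uminus UT.uminus_zero split: if_splits)
qed

text \<open>Used for the identity of \<open>R\<close> and for the projection to
  \<open>R Quot J\<close>, so that graded right ideals of both rings get the same description. Only
  left multiplication by units is required, as a right ideal is closed under right multiplication;
  units on both sides cut an element into its homogeneous parts.\<close>

lemma graded_image_iff:
  fixes Q :: "('q, 'n) ring_scheme" (structure)
  assumes Q: "nonunital_ring Q"
    and f_carrier: "f ` carrier R = carrier Q"
    and f_add: "\<And>x y. x \<in> carrier R \<Longrightarrow> y \<in> carrier R \<Longrightarrow> f (x \<oplus>\<^bsub>R\<^esub> y) = f x \<oplus>\<^bsub>Q\<^esub> f y"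
    and f_mult: "\<And>x y. x \<in> carrier R \<Longrightarrow> y \<in> carrier R \<Longrightarrow> f (x \<otimes>\<^bsub>R\<^esub> y) = f x \<otimes>\<^bsub>Q\<^esub> f y"
    and S: "right_ideal Q S"
  shows "is_direct_sum Q (I \<times> I) (\<lambda>\<gamma>. S \<inter> f ` UT_grading A \<gamma>) S \<longleftrightarrow>
         (\<forall>i\<in>I. \<forall>s\<in>S. f (UT_unit A i) \<otimes>\<^bsub>Q\<^esub> s \<in> S)"
proof -
  interpret Q: nonunital_ring Q by fact
  let ?u = "UT_unit A" and ?F = "\<lambda>\<gamma>. S \<inter> f ` UT_grading A \<gamma>"
  note SD = Q.right_idealD[OF S]
  have fc: "x \<in> carrier R \<Longrightarrow> f x \<in> carrier Q" for x using f_carrier by blast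
  have f0: "f \<zero>\<^bsub>R\<^esub> = \<zero>\<^bsub>Q\<^esub>"
    using f_add[of "\<zero>\<^bsub>R\<^esub>" "\<zero>\<^bsub>R\<^esub>"] fc[of "\<zero>\<^bsub>R\<^esub>"] by (simp add: Q.add.l_cancel_one')
  have f_uminus: "f (\<ominus>\<^bsub>R\<^esub> x) = \<ominus>\<^bsub>Q\<^esub> f x" if "x \<in> carrier R" for x
    using that f_add[of "\<ominus>\<^bsub>R\<^esub> x" x] by (intro Q.minus_equality[symmetric]) (auto simp: fc UT.l_neg f0)
  have fu: "i \<in> I \<Longrightarrow> f (?u i) \<in> carrier Q" for i by (simp add: fc UT_unit_closed)
  have S_subgroup: "additive_subgroup S Q" using S by (simp add: right_ideal_def)
  have G_sub: "i \<in> I \<Longrightarrow> j \<in> I \<Longrightarrow> x \<in> UT_grading A (i, j) \<Longrightarrow> x \<in> carrier R" for i j x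
    using UT_grading_subset by blast
  have fu_left: "f (?u i) \<otimes>\<^bsub>Q\<^esub> f x = (if i = k then f x else \<zero>\<^bsub>Q\<^esub>)"
    and fu_right: "f x \<otimes>\<^bsub>Q\<^esub> f (?u i) = (if i = l then f x else \<zero>\<^bsub>Q\<^esub>)"
    if "i \<in> I" "k \<in> I" "l \<in> I" "x \<in> UT_grading A (k, l)" for i k l x
    using UT_unit_mult_grading[OF that] that G_sub[OF that(2-4)] f0
    by (simp_all flip: f_mult add: UT_unit_closed)
  have F_subgroup: "additive_subgroup (?F (i, j)) Q" if ij: "i \<in> I" "j \<in> I" for i j
  proof -
    interpret G: additive_subgroup "UT_grading A (i, j)" R by (rule UT_grading_subgroup[OF ij])
    show ?thesis
    proof (rule Q.add_subgroupI)
      have "f \<zero>\<^bsub>R\<^esub> \<in> f ` UT_grading A (i, j)" by (intro imageI G.zero_closed)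
      then show "\<zero>\<^bsub>Q\<^esub> \<in> ?F (i, j)" using SD(2) f0 by simp
      show "s \<oplus>\<^bsub>Q\<^esub> t \<in> ?F (i, j)" if st: "s \<in> ?F (i, j)" "t \<in> ?F (i, j)" for s t
      proof -
        obtain x y where xy: "x \<in> UT_grading A (i, j)" "y \<in> UT_grading A (i, j)" "s = f x" "t = f y"
          using st by blast
        then have "f (x \<oplus>\<^bsub>R\<^esub> y) \<in> f ` UT_grading A (i, j)" by (intro imageI G.a_closed)
        then show ?thesis using SD(3)[of s t] st xy G_sub[OF ij] by (simp add: f_add)
      qed
      show "\<ominus>\<^bsub>Q\<^esub> s \<in> ?F (i, j)" if s: "s \<in> ?F (i, j)" for s
      proof -
        obtain x where x: "x \<in> UT_grading A (i, j)" "s = f x" using s by blast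
        then have "f (\<ominus>\<^bsub>R\<^esub> x) \<in> f ` UT_grading A (i, j)" by (intro imageI G.a_inv_closed)
        then show ?thesis using SD(4)[of s] s x G_sub[OF ij] by (simp add: f_uminus)
      qed
    qed (use SD(1) in auto)
  qed
  have indep: "?F (k, l) \<inter> sum_family Q (?F ` (I \<times> I - {(k, l)})) = {\<zero>\<^bsub>Q\<^esub>}"
    if kl: "k \<in> I" "l \<in> I" for k l
  proof -
    \<comment> \<open>The map taking \<open>t\<close> to \<open>1_k t 1_l\<close> kills every
      component except the one at \<open>(k, l)\<close>, on which it is the identity. Its kernel
      \<open>?H\<close> therefore contains the sum of all the others.\<close>
    let ?H = "{t \<in> carrier Q. f (?u k) \<otimes>\<^bsub>Q\<^esub> t \<otimes>\<^bsub>Q\<^esub> f (?u l) = \<zero>\<^bsub>Q\<^esub>}"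
    let ?T = "sum_family Q (?F ` (I \<times> I - {(k, l)}))"
    have "additive_subgroup ?H Q"
      using fu[OF kl(1)] fu[OF kl(2)]
      by (intro Q.add_subgroupI)
         (auto simp: Q.r_null Q.l_null Q.r_distr Q.l_distr Q.m_closed Q.r_minus Q.l_minus Q.uminus_zero)
    moreover have "?F \<gamma> \<subseteq> ?H" if "\<gamma> \<in> I \<times> I - {(k, l)}" for \<gamma>
    proof
      fix s assume s: "s \<in> ?F \<gamma>"
      obtain i j where \<gamma>: "\<gamma> = (i, j)" "i \<in> I" "j \<in> I" "(i, j) \<noteq> (k, l)" using \<open>\<gamma> \<in> _\<close> by auto
      obtain x where x: "x \<in> UT_grading A (i, j)" "s = f x" using s \<gamma> by auto
      then show "s \<in> ?H"
        using \<gamma> kl fc[OF G_sub[OF \<gamma>(2,3) x(1)]] fu[OF kl(2)]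
        by (auto simp: fu_left[OF kl(1) \<gamma>(2,3) x(1)] fu_right[OF kl(2) \<gamma>(2,3) x(1)] Q.l_null)
    qed
    ultimately have T: "?T \<subseteq> ?H" by (intro Q.sum_family_minimal) auto
    have "s = \<zero>\<^bsub>Q\<^esub>" if s: "s \<in> ?F (k, l)" "s \<in> ?T" for s
    proof -
      obtain x where x: "x \<in> UT_grading A (k, l)" "s = f x" using s by auto
      then have "f (?u k) \<otimes>\<^bsub>Q\<^esub> s \<otimes>\<^bsub>Q\<^esub> f (?u l) = s"
        using kl by (simp add: fu_left[OF kl(1) kl x(1)] fu_right[OF kl(2) kl x(1)])
      then show ?thesis using T s(2) by auto
    qed
    moreover have "\<zero>\<^bsub>Q\<^esub> \<in> ?F (k, l)"
      using additive_subgroup.zero_closed[OF F_subgroup[OF kl]] .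
    moreover have "\<zero>\<^bsub>Q\<^esub> \<in> ?T"
      using generate.one[of "add_monoid Q"] by (simp add: sum_family_def)
    ultimately show ?thesis by blast
  qed
  have upper: "sum_family Q (?F ` (I \<times> I)) \<subseteq> S"
    by (rule Q.sum_family_minimal[OF S_subgroup]) auto
  show ?thesis
  proof
    assume "is_direct_sum Q (I \<times> I) ?F S"
    then have eq: "S = sum_family Q (?F ` (I \<times> I))" by (simp add: is_direct_sum_def)
    show "\<forall>i\<in>I. \<forall>s\<in>S. f (?u i) \<otimes>\<^bsub>Q\<^esub> s \<in> S"
    proof (intro ballI)
      fix i s assume i: "i \<in> I" and s: "s \<in> S"
      \<comment> \<open>A unit acts on each component as the identity or as zero, so
        \<open>?H\<close> contains all components of \<open>S\<close> and hence
        \<open>S\<close>.\<close>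
      let ?H = "{t \<in> carrier Q. f (?u i) \<otimes>\<^bsub>Q\<^esub> t \<in> S}"
      have "additive_subgroup ?H Q"
        using fu[OF i] SD by (intro Q.add_subgroupI) (auto simp: Q.r_null Q.r_distr Q.r_minus)
      moreover have "?F (k, l) \<subseteq> ?H" if kl: "k \<in> I" "l \<in> I" for k l
        using SD(1,2) fu_left[OF i kl] by auto
      ultimately have "sum_family Q (?F ` (I \<times> I)) \<subseteq> ?H" by (intro Q.sum_family_minimal) auto
      then show "f (?u i) \<otimes>\<^bsub>Q\<^esub> s \<in> S" using s eq by auto
    qed
  next
    assume stable: "\<forall>i\<in>I. \<forall>s\<in>S. f (?u i) \<otimes>\<^bsub>Q\<^esub> s \<in> S"
    have "S \<subseteq> sum_family Q (?F ` (I \<times> I))" (is "_ \<subseteq> ?T")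
    proof
      fix s assume s: "s \<in> S"
      then obtain x where x: "x \<in> carrier R" "s = f x" using SD(1) f_carrier by blast
      interpret T: additive_subgroup ?T Q
        by (rule Q.sum_family_additive_subgroup) (use SD(1) in auto)
      \<comment> \<open>The preimage of the sum is a subgroup of \<open>R\<close>, so it is enough
        to treat the entries of \<open>x\<close>. The part at \<open>(i, j)\<close> is mapped to
        \<open>s\<close> cut by the images of two units, which lies in \<open>S\<close> by
        stability.\<close>
      have H: "additive_subgroup {y \<in> carrier R. f y \<in> ?T} R"
        by (rule UT.add_subgroupI) (auto simp: f0 f_add f_uminus)
      have "x \<in> {y \<in> carrier R. f y \<in> ?T}"
      proof (rule UT_mem_subgroupI[OF H x(1)])
        fix i j assume ij: "i \<in> I" "j \<in> I"
        have e: "E (x i j) i j = ?u i \<otimes>\<^bsub>R\<^esub> x \<otimes>\<^bsub>R\<^esub> ?u j"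
          using ij x by (simp add: UT_unit_sandwich)
        have c: "E (x i j) i j \<in> carrier R"
          unfolding e using ij x by (simp add: UT.m_closed UT_unit_closed)
        have "f (E (x i j) i j) = f (?u i) \<otimes>\<^bsub>Q\<^esub> s \<otimes>\<^bsub>Q\<^esub> f (?u j)"
          unfolding e using ij x by (simp add: f_mult UT.m_closed UT_unit_closed)
        then have "f (E (x i j) i j) \<in> S" using stable s ij SD(5) fu by simp
        moreover have "E (x i j) i j \<in> UT_grading A (i, j)"
          using UT_grading_mem_iff[OF ij c] by (simp add: single_entry_apply)
        ultimately have "f (E (x i j) i j) \<in> ?F (i, j)" by blast
        then have "f (E (x i j) i j) \<in> ?T"
          using sum_family_upper[of "?F (i, j)" "?F ` (I \<times> I)" Q] ij by blast
        then show "E (x i j) i j \<in> {y \<in> carrier R. f y \<in> ?T}" using c by simp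
      qed
      then show "s \<in> ?T" using x by simp
    qed
    then show "is_direct_sum Q (I \<times> I) ?F S"
      unfolding is_direct_sum_def using F_subgroup indep upper by auto
  qed
qed

lemma UT_pair_graded_ring: "pair_graded_ring R I (UT_grading A) (UT_unit A)"
proof (intro pair_graded_ring.intro UT_nonunital_ring pair_graded_ring_axioms.intro)
  have "right_ideal R (carrier R)" by (rule UT.right_idealI) (auto simp: UT.m_closed)
  \<comment> \<open>The criterion is applied with \<open>f\<close> the identity and with the whole
    ring as right ideal.\<close>
  then have "is_direct_sum R (I \<times> I) (\<lambda>\<gamma>. carrier R \<inter> (\<lambda>x. x) ` UT_grading A \<gamma>) (carrier R)"
    by (subst graded_image_iff[OF UT_nonunital_ring]) (auto simp: UT_unit_closed UT.m_closed)
  moreover have "carrier R \<inter> (\<lambda>x. x) ` UT_grading A \<gamma> = UT_grading A \<gamma>" if "\<gamma> \<in> I \<times> I" for \<gamma>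
    using that UT_grading_subset by auto
  ultimately show "is_direct_sum R (I \<times> I) (UT_grading A) (carrier R)"
    by (subst (asm) is_direct_sum_cong[where F' = "UT_grading A"]) auto
next
  fix k j i x y assume "k \<in> I" "j \<in> I" "i \<in> I" "x \<in> UT_grading A (k, j)" "y \<in> UT_grading A (j, i)"
  note * = this
  then have c: "x \<in> carrier R" "y \<in> carrier R" using UT_grading_subset by blast+
  \<comment> \<open>As \<open>x\<close> and \<open>y\<close> are homogeneous, \<open>xy\<close> is
    unchanged by cutting with the outer units, so only its entry at \<open>(k, i)\<close> can be
    nonzero.\<close>
  have "x \<otimes>\<^bsub>R\<^esub> y = UT_unit A k \<otimes>\<^bsub>R\<^esub> (x \<otimes>\<^bsub>R\<^esub> y) \<otimes>\<^bsub>R\<^esub> UT_unit A i"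
    using * c UT_unit_mult_grading(1)[of k k j x] UT_unit_mult_grading(2)[of i j i y]
    by (simp add: UT.m_assoc UT.m_closed UT_unit_closed flip: UT.m_assoc[of _ x])
  also have "\<dots> = E ((x \<otimes>\<^bsub>R\<^esub> y) k i) k i"
    using * c by (intro UT_unit_sandwich) (auto simp: UT.m_closed)
  finally show "x \<otimes>\<^bsub>R\<^esub> y \<in> UT_grading A (k, i)"
    using UT_grading_mem_iff * c UT.m_closed by blast
next
  fix k j l i x y
  assume "k \<in> I" "j \<in> I" "l \<in> I" "i \<in> I" "j \<noteq> l" "x \<in> UT_grading A (k, j)" "y \<in> UT_grading A (l, i)"
  note * = this
  then have c: "x \<in> carrier R" "y \<in> carrier R" using UT_grading_subset by blast+
  have "x \<otimes>\<^bsub>R\<^esub> y = (x \<otimes>\<^bsub>R\<^esub> UT_unit A j) \<otimes>\<^bsub>R\<^esub> y"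
    using * UT_unit_mult_grading(2)[of j k j x] by simp
  also have "\<dots> = x \<otimes>\<^bsub>R\<^esub> (UT_unit A j \<otimes>\<^bsub>R\<^esub> y)"
    using * c by (simp add: UT.m_assoc UT_unit_closed)
  also have "\<dots> = \<zero>\<^bsub>R\<^esub>"
    using * c UT_unit_mult_grading(1)[of j l i y] by (simp add: UT.r_null)
  finally show "x \<otimes>\<^bsub>R\<^esub> y = \<zero>\<^bsub>R\<^esub>" .
qed (auto simp: UT_unit_mult_grading, auto simp: UT_unit_def UT_grading_apply)

lemma gr_right_ideal_UT_iff:
  "gr_right_ideal R (I \<times> I) (UT_grading A) V \<longleftrightarrow> V \<in> stable_right_ideals R (UT_unit A ` I)"
proof (cases "right_ideal R V")
  case True
  have "is_direct_sum R (I \<times> I) (\<lambda>\<gamma>. V \<inter> (\<lambda>x. x) ` UT_grading A \<gamma>) V \<longleftrightarrow>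
      (\<forall>i\<in>I. \<forall>s\<in>V. UT_unit A i \<otimes>\<^bsub>R\<^esub> s \<in> V)"
    by (rule graded_image_iff[OF UT_nonunital_ring _ _ _ True]) auto
  then show ?thesis using True by (simp add: gr_right_ideal_def stable_right_ideals_def)
qed (simp add: gr_right_ideal_def stable_right_ideals_def)

text \<open>With the projection as \<open>f\<close>, \<open>graded_image_iff\<close> identifies the
  graded right ideals of the quotient as those stable under the cosets of the units; the
  correspondence theorem then moves the question into \<open>R\<close>.\<close>

lemma gr_semisimple_Quot_iff:
  assumes "two_sided_ideal R J"
  shows "gr_semisimple (R Quot J) (I \<times> I) (quotient_grading R (UT_grading A) J) \<longleftrightarrow>
    atoms_span {V. gr_right_ideal R (I \<times> I) (UT_grading A) V \<and> J \<subseteq> V} J (carrier R)"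
proof -
  interpret J: two_sided_ideal R J by fact
  \<comment> \<open>Adding elements of \<open>J\<close> does not change cosets, so the quotient
    grading is the image of the grading of \<open>R\<close>.\<close>
  have grading: "quotient_grading R (UT_grading A) J \<gamma> = (+>\<^bsub>R\<^esub>) J ` UT_grading A \<gamma>"
    if \<gamma>: "\<gamma> \<in> I \<times> I" for \<gamma>
  proof -
    have G: "x \<in> carrier R" if "x \<in> UT_grading A \<gamma>" for x using that UT_grading_subset \<gamma> by auto
    have eq: "J +>\<^bsub>R\<^esub> (x \<oplus>\<^bsub>R\<^esub> y) = J +>\<^bsub>R\<^esub> x" if "x \<in> UT_grading A \<gamma>" "y \<in> J" for x y
    proof -
      have c: "x \<in> carrier R" "y \<in> carrier R" using G[OF that(1)] that(2) by auto
      then have "x \<oplus>\<^bsub>R\<^esub> y \<oplus>\<^bsub>R\<^esub> \<ominus>\<^bsub>R\<^esub> x = y"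
        by (metis UT.a_assoc UT.a_comm UT.a_inv_closed UT.add.m_closed UT.r_neg1)
      then show ?thesis using c that(2) by (simp add: J.coset_eq_iff)
    qed
    have sub: "UT_grading A \<gamma> \<subseteq> UT_grading A \<gamma> <+>\<^bsub>R\<^esub> J"
    proof
      fix x assume x: "x \<in> UT_grading A \<gamma>"
      then have "x \<oplus>\<^bsub>R\<^esub> \<zero>\<^bsub>R\<^esub> \<in> UT_grading A \<gamma> <+>\<^bsub>R\<^esub> J"
        using J.zero_closed unfolding set_add_def' by blast
      then show "x \<in> UT_grading A \<gamma> <+>\<^bsub>R\<^esub> J" using G[OF x] by simp
    qed
    show ?thesis
      unfolding quotient_grading_def
    proof
      show "(+>\<^bsub>R\<^esub>) J ` (UT_grading A \<gamma> <+>\<^bsub>R\<^esub> J) \<subseteq> (+>\<^bsub>R\<^esub>) J ` UT_grading A \<gamma>"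
        using eq by (auto simp: set_add_def')
    qed (use sub in blast)
  qed
  have "gr_right_ideal (R Quot J) (I \<times> I) (quotient_grading R (UT_grading A) J) S \<longleftrightarrow>
      S \<in> stable_right_ideals (R Quot J) ((+>\<^bsub>R\<^esub>) J ` UT_unit A ` I)" for S
  proof (cases "right_ideal (R Quot J) S")
    case True
    have "is_direct_sum (R Quot J) (I \<times> I) (\<lambda>\<gamma>. S \<inter> quotient_grading R (UT_grading A) J \<gamma>) S \<longleftrightarrow>
        is_direct_sum (R Quot J) (I \<times> I) (\<lambda>\<gamma>. S \<inter> (+>\<^bsub>R\<^esub>) J ` UT_grading A \<gamma>) S"
      using grading by (intro is_direct_sum_cong) simp
    also have "\<dots> \<longleftrightarrow> (\<forall>i\<in>I. \<forall>s\<in>S. (J +>\<^bsub>R\<^esub> UT_unit A i) \<otimes>\<^bsub>R Quot J\<^esub> s \<in> S)"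
      by (rule graded_image_iff[OF J.quotient_nonunital_ring _ _ _ True])
         (auto simp: J.carrier_Quot J.add_Quot J.mult_Quot)
    finally show ?thesis using True by (simp add: gr_right_ideal_def stable_right_ideals_def)
  qed (simp add: gr_right_ideal_def stable_right_ideals_def)
  then have "gr_semisimple (R Quot J) (I \<times> I) (quotient_grading R (UT_grading A) J) \<longleftrightarrow>
    carrier (R Quot J) = sum_family (R Quot J)
      (atoms_over (stable_right_ideals (R Quot J) ((+>\<^bsub>R\<^esub>) J ` UT_unit A ` I)) {\<zero>\<^bsub>R Quot J\<^esub>})"
    unfolding gr_semisimple_def gr_simple_right_ideal_def atoms_over_def
    by (simp add: Ball_def imp_conjL)
  also have "\<dots> \<longleftrightarrow> atoms_span {V \<in> stable_right_ideals R (UT_unit A ` I). J \<subseteq> V} J (carrier R)"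
    by (rule J.quotient_atoms_span_iff) (auto simp: UT_unit_closed)
  finally show ?thesis by (simp add: gr_right_ideal_UT_iff)
qed

end

section \<open>The graded radical\<close>

context UT_ring
begin

interpretation nonunital_A: nonunital_ring A
  by (rule nonunital_ring)

section \<open>Graded right ideals determined by their diagonal\<close>

abbreviation gr :: "('i \<Rightarrow> 'i \<Rightarrow> 'a) set \<Rightarrow> bool" where
  "gr \<equiv> gr_right_ideal R (I \<times> I) (UT_grading A)"

text \<open>Off-diagonal entries are left free. If every \<open>W i\<close> contains
  \<open>\<zero>\<close>, all strictly upper triangular matrices belong to the set, and for
  \<open>W\<close> constantly \<open>{\<zero>}\<close> nothing else does. Only the values of
  \<open>W\<close> on \<open>I\<close> matter.\<close>

definition diag_ideal :: "('i \<Rightarrow> 'a set) \<Rightarrow> ('i \<Rightarrow> 'i \<Rightarrow> 'a) set" where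
  "diag_ideal W = {x \<in> carrier R. \<forall>i\<in>I. x i i \<in> W i}"

text \<open>For a graded right ideal \<open>V\<close> and \<open>i \<in> I\<close> this is also the
  set of all diagonal entries \<open>x i i\<close> with \<open>x \<in> V\<close>, by
  \<open>gr_entry\<close>.\<close>

definition diag_part :: "('i \<Rightarrow> 'i \<Rightarrow> 'a) set \<Rightarrow> 'i \<Rightarrow> 'a set" where
  "diag_part V i = {a \<in> carrier A. E a i i \<in> V}"

lemma gr_diag_ideal:
  assumes "\<And>i. i \<in> I \<Longrightarrow> right_ideal A (W i)"
  shows "gr (diag_ideal W)"
proof -
  note D = nonunital_A.right_idealD[OF assms]
  have "right_ideal R (diag_ideal W)"
    by (rule UT.right_idealI)
       (auto simp: diag_ideal_def D add_UT uminus_UT diagonal_mult UT.m_closed UT_entry_closed,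
        simp add: zero_UT D)
  moreover have "UT_unit A i \<otimes>\<^bsub>R\<^esub> x \<in> diag_ideal W" if "i \<in> I" "x \<in> diag_ideal W" for i x
  proof -
    have x: "x \<in> carrier R" using that by (simp add: diag_ideal_def)
    then have "UT_unit A i \<otimes>\<^bsub>R\<^esub> x \<in> carrier R" using that by (simp add: UT_unit_closed UT.m_closed)
    then show ?thesis using that x by (auto simp: diag_ideal_def UT_unit_mult_left D)
  qed
  ultimately show ?thesis by (auto simp: gr_right_ideal_UT_iff stable_right_ideals_def)
qed

lemma gr_right_ideal: "gr V \<Longrightarrow> right_ideal R V"
  by (simp add: gr_right_ideal_def)

lemma gr_entry:
  assumes V: "gr V" and x: "x \<in> V" and ij: "i \<in> I" "j \<in> I"
  shows "E (x i j) i j \<in> V"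
proof -
  have "UT_unit A i \<otimes>\<^bsub>R\<^esub> x \<in> V"
    using V x ij by (simp add: gr_right_ideal_UT_iff stable_right_ideals_def)
  from UT.right_idealD(5)[OF gr_right_ideal[OF V] this UT_unit_closed[OF ij(2)]]
  show ?thesis
    using UT_unit_sandwich[OF ij, of x] UT.right_idealD(1)[OF gr_right_ideal[OF V]] x by auto
qed

lemma diag_part_right_ideal:
  assumes V: "gr V" and i: "i \<in> I"
  shows "right_ideal A (diag_part V i)"
proof -
  note VD = UT.right_idealD[OF gr_right_ideal[OF V]]
  show ?thesis
  proof (rule nonunital_A.right_idealI)
    show "\<zero> \<in> diag_part V i" using VD(2) by (simp add: diag_part_def single_entry_zero)
    show "a \<oplus> b \<in> diag_part V i" if "a \<in> diag_part V i" "b \<in> diag_part V i" for a b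
      using that VD(3)[of "E a i i" "E b i i"] by (simp add: diag_part_def single_entry_add)
    show "\<ominus> a \<in> diag_part V i" if "a \<in> diag_part V i" for a
      using that VD(4)[of "E a i i"] i by (simp add: diag_part_def single_entry_uminus)
    show "a \<otimes> r \<in> diag_part V i" if "a \<in> diag_part V i" "r \<in> carrier A" for a r
      using that VD(5)[of "E a i i" "E r i i"] i
      by (simp add: diag_part_def single_entry_mult single_entry_closed)
  qed (simp add: diag_part_def)
qed

lemma gr_subset_diag_ideal:
  assumes "gr V" shows "V \<subseteq> diag_ideal (diag_part V)"
  using gr_entry[OF assms] UT.right_idealD(1)[OF gr_right_ideal[OF assms]]
  by (auto simp: diag_ideal_def diag_part_def UT_entry_closed)

text \<open>Entries above the diagonal are unrestricted by assumption, all other off-diagonal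
  entries vanish, and the diagonal ones can be treated one by one because \<open>V\<close> is
  graded.\<close>

lemma gr_eq_diag_ideal:
  assumes V: "gr V" and sub: "diag_ideal (\<lambda>_. {\<zero>}) \<subseteq> V"
  shows "V = diag_ideal (diag_part V)"
proof
  note V' = gr_right_ideal[OF V]
  show "diag_ideal (diag_part V) \<subseteq> V"
  proof
    fix x assume x: "x \<in> diag_ideal (diag_part V)"
    then have xc: "x \<in> carrier R" by (simp add: diag_ideal_def)
    show "x \<in> V"
    proof (rule UT_mem_subgroupI[OF _ xc])
      show "additive_subgroup V R" using V' by (simp add: right_ideal_def)
      fix i j assume ij: "i \<in> I" "j \<in> I"
      consider "i = j" | "i < j" | "\<not> i \<le> j" by (auto simp: less_le)
      then show "E (x i j) i j \<in> V"
      proof cases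
        case 1
        then show ?thesis using x ij by (simp add: diag_ideal_def diag_part_def)
      next
        case 2
        then have "E (x i j) i j \<in> diag_ideal (\<lambda>_. {\<zero>})"
          using xc ij by (auto simp: diag_ideal_def single_entry_closed UT_entry_closed single_entry_apply)
        then show ?thesis using sub by blast
      next
        case 3
        then show ?thesis
          using UT_entry_zero[OF xc, of i j] UT.right_idealD(2)[OF V'] by (simp add: single_entry_zero)
      qed
    qed
  qed
qed (rule gr_subset_diag_ideal[OF V])

lemma diag_ideal_subset_iff:
  assumes "\<And>i. i \<in> I \<Longrightarrow> right_ideal A (W i)" "\<And>i. i \<in> I \<Longrightarrow> right_ideal A (W' i)"
  shows "diag_ideal W \<subseteq> diag_ideal W' \<longleftrightarrow> (\<forall>i\<in>I. W i \<subseteq> W' i)"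
proof
  assume sub: "diag_ideal W \<subseteq> diag_ideal W'"
  show "\<forall>i\<in>I. W i \<subseteq> W' i"
  proof (intro ballI subsetI)
    fix i a assume i: "i \<in> I" and a: "a \<in> W i"
    then have "a \<in> carrier A" using nonunital_A.right_idealD(1)[OF assms(1)] by blast
    \<comment> \<open>The remaining diagonal entries of this matrix are zero, and zero belongs to
      every \<open>W k\<close>.\<close>
    with i a have "E a i i \<in> diag_ideal W"
      using nonunital_A.right_idealD(2)[OF assms(1)]
      by (auto simp: diag_ideal_def single_entry_closed single_entry_apply)
    with sub have "E a i i \<in> diag_ideal W'" by blast
    with i have "E a i i i i \<in> W' i" by (simp add: diag_ideal_def)
    then show "a \<in> W' i" by (simp add: single_entry_apply)
  qed
qed (auto simp: diag_ideal_def)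

lemma diag_ideal_eq_iff:
  assumes "\<And>i. i \<in> I \<Longrightarrow> right_ideal A (W i)" "\<And>i. i \<in> I \<Longrightarrow> right_ideal A (W' i)"
  shows "diag_ideal W = diag_ideal W' \<longleftrightarrow> (\<forall>i\<in>I. W i = W' i)"
  using diag_ideal_subset_iff[of W W', OF assms] diag_ideal_subset_iff[of W' W, OF assms(2,1)] by blast

lemma diag_ideal_carrier: "diag_ideal (\<lambda>_. carrier A) = carrier R"
  by (auto simp: diag_ideal_def UT_entry_closed)

lemma right_ideal_carrier: "right_ideal A (carrier A)"
  by (rule nonunital_A.right_idealI) auto

lemma diag_zero_subset:
  assumes "\<And>i. i \<in> I \<Longrightarrow> right_ideal A (W i)" shows "diag_ideal (\<lambda>_. {\<zero>}) \<subseteq> diag_ideal W"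
  using nonunital_A.right_idealD(2)[OF assms] by (auto simp: diag_ideal_def)

text \<open>Turns questions about graded right ideals above a given \<open>diag_ideal\<close> into
  componentwise questions about right ideals of \<open>A\<close>.\<close>

lemma gr_superset_diag_ideal:
  assumes W: "\<And>i. i \<in> I \<Longrightarrow> right_ideal A (W i)" and V: "gr V" and sub: "diag_ideal W \<subseteq> V"
  obtains W' where "V = diag_ideal W'" "\<And>i. i \<in> I \<Longrightarrow> right_ideal A (W' i)" "\<And>i. i \<in> I \<Longrightarrow> W i \<subseteq> W' i"
proof (rule that)
  show eq: "V = diag_ideal (diag_part V)"
    using diag_zero_subset[of W] W sub by (intro gr_eq_diag_ideal[OF V]) auto
  show R: "\<And>i. i \<in> I \<Longrightarrow> right_ideal A (diag_part V i)" by (rule diag_part_right_ideal[OF V])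
  show "\<And>i. i \<in> I \<Longrightarrow> W i \<subseteq> diag_part V i"
    using sub eq diag_ideal_subset_iff[of W "diag_part V", OF W R] by auto
qed

section \<open>Gr-maximal right ideals and the graded radical\<close>

lemma gr_maximal_diag_ideal:
  assumes i: "i \<in> I" and M: "maximal_right_ideal A M"
  shows "gr_maximal_right_ideal R (I \<times> I) (UT_grading A) (diag_ideal ((\<lambda>_. carrier A)(i := M)))"
    (is "gr_maximal_right_ideal _ _ _ (diag_ideal ?W)")
proof -
  have W: "right_ideal A (?W k)" for k
    using M right_ideal_carrier by (auto simp: maximal_right_ideal_def)
  have "diag_ideal ?W \<noteq> carrier R"
    unfolding diag_ideal_carrier[symmetric] using i M
    by (subst diag_ideal_eq_iff) (auto simp: W right_ideal_carrier maximal_right_ideal_def)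
  moreover have "V = diag_ideal ?W \<or> V = carrier R" if V: "gr V" "diag_ideal ?W \<subseteq> V" for V
  proof -
    obtain W' where W': "V = diag_ideal W'" "\<And>k. k \<in> I \<Longrightarrow> right_ideal A (W' k)"
      "\<And>k. k \<in> I \<Longrightarrow> ?W k \<subseteq> W' k"
      using gr_superset_diag_ideal[OF W V] by blast
    \<comment> \<open>All components except the one at \<open>i\<close> are already
      \<open>A\<close>; at \<open>i\<close> the maximality of \<open>M\<close> decides.\<close>
    have other: "W' k = carrier A" if "k \<in> I" "k \<noteq> i" for k
      using W'(3)[OF that(1)] nonunital_A.right_idealD(1)[OF W'(2)[OF that(1)]] that by auto
    have "W' i = M \<or> W' i = carrier A"
      using M W'(2,3)[OF i] by (simp add: maximal_right_ideal_def)
    then show ?thesis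
    proof
      assume "W' i = M"
      then have "V = diag_ideal ?W" using other by (auto simp: W'(1) diag_ideal_def)
      then show ?thesis ..
    next
      assume "W' i = carrier A"
      then have "W' k = carrier A" if "k \<in> I" for k using other that by (cases "k = i") auto
      then have "V = carrier R" by (auto simp: W'(1) diag_ideal_def UT_entry_closed)
      then show ?thesis ..
    qed
  qed
  moreover have "gr (diag_ideal ?W)" by (rule gr_diag_ideal) (rule W)
  ultimately show ?thesis unfolding gr_maximal_right_ideal_def by blast
qed

text \<open>It is not clear beforehand that \<open>V\<close> contains the strictly upper triangular
  matrices. But \<open>V\<close> lies in the ideal that restricts only the diagonal entry at one
  \<open>i\<close> with proper \<open>diag_part V i\<close>. That ideal is graded and proper, so
  maximality makes it equal to \<open>V\<close>.\<close>

lemma gr_maximal_imp_diag_ideal: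
  assumes V: "gr_maximal_right_ideal R (I \<times> I) (UT_grading A) V"
  obtains i M where "i \<in> I" "maximal_right_ideal A M" "V = diag_ideal ((\<lambda>_. carrier A)(i := M))"
proof -
  have gr: "gr V" and ne: "V \<noteq> carrier R"
    and max: "\<And>U. gr U \<Longrightarrow> V \<subseteq> U \<Longrightarrow> U = V \<or> U = carrier R"
    using V by (auto simp: gr_maximal_right_ideal_def)
  note P = diag_part_right_ideal[OF gr]
  \<comment> \<open>Otherwise \<open>V\<close> contains all units and thus every
    \<open>E a i j\<close>, which is unchanged by multiplication with \<open>E \<one> i i\<close>
    from the left.\<close>
  have "\<exists>i\<in>I. diag_part V i \<noteq> carrier A"
  proof (rule ccontr)
    assume "\<not> ?thesis"
    then have one: "E \<one> i i \<in> V" if "i \<in> I" for i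
      using that by (auto simp: diag_part_def)
    note V' = gr_right_ideal[OF gr]
    have "x \<in> V" if x: "x \<in> carrier R" for x
    proof (rule UT_mem_subgroupI[OF _ x])
      show "additive_subgroup V R" using V' by (simp add: right_ideal_def)
      fix i j assume ij: "i \<in> I" "j \<in> I"
      show "E (x i j) i j \<in> V"
      proof (cases "i \<le> j")
        case True
        have "E \<one> i i \<otimes>\<^bsub>R\<^esub> E (x i j) i j \<in> V"
          using UT.right_idealD(5)[OF V' one[OF ij(1)]] ij True x
          by (simp add: single_entry_closed UT_entry_closed)
        then show ?thesis using ij True x by (simp add: single_entry_mult UT_entry_closed)
      next
        case False
        then show ?thesis
          using UT_entry_zero[OF x, of i j] UT.right_idealD(2)[OF V'] by (simp add: single_entry_zero)
      qed
    qed
    then show False using ne UT.right_idealD(1)[OF V'] by blast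
  qed
  then obtain i where i: "i \<in> I" and proper: "diag_part V i \<noteq> carrier A" by blast
  let ?D = "\<lambda>M. diag_ideal ((\<lambda>_. carrier A)(i := M))"
  have gr_D: "gr (?D M)" if "right_ideal A M" for M
    using that right_ideal_carrier by (intro gr_diag_ideal) auto
  have D_eq: "?D M = ?D M' \<longleftrightarrow> M = M'" if "right_ideal A M" "right_ideal A M'" for M M'
    using that right_ideal_carrier i by (subst diag_ideal_eq_iff) auto
  have top: "?D (carrier A) = carrier R"
    using diag_ideal_carrier by (auto simp: diag_ideal_def)
  have V_sub: "V \<subseteq> ?D (diag_part V i)"
    using gr_subset_diag_ideal[OF gr] by (auto simp: diag_ideal_def UT_entry_closed)
  have "?D (diag_part V i) \<noteq> carrier R"
    using proper D_eq[OF P[OF i] right_ideal_carrier] top by simp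
  with max[OF gr_D[OF P[OF i]] V_sub] have V_eq: "V = ?D (diag_part V i)" by simp
  \<comment> \<open>A right ideal of \<open>A\<close> above \<open>diag_part V i\<close> yields a
    graded right ideal above \<open>V\<close>, and different right ideals yield different graded
    ones.\<close>
  have "maximal_right_ideal A (diag_part V i)"
    unfolding maximal_right_ideal_def
  proof (intro conjI allI impI)
    fix U assume U: "right_ideal A U \<and> diag_part V i \<subseteq> U"
    then have "?D (diag_part V i) \<subseteq> ?D U" by (auto simp: diag_ideal_def split: if_splits)
    with V_sub have "V \<subseteq> ?D U" by (rule subset_trans)
    with max gr_D U have "?D U = ?D (diag_part V i) \<or> ?D U = ?D (carrier A)"
      using V_eq top by metis
    then show "U = diag_part V i \<or> U = carrier A"
      using D_eq U P[OF i] right_ideal_carrier by blast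
  qed (use P[OF i] proper in auto)
  then show thesis using that i V_eq by blast
qed

abbreviation J where "J \<equiv> diag_ideal (\<lambda>_. jacobson_radical A)"

lemma gr_radical_UT: "gr_radical R (I \<times> I) (UT_grading A) = J"
proof
  show "gr_radical R (I \<times> I) (UT_grading A) \<subseteq> J"
  proof
    fix x assume x: "x \<in> gr_radical R (I \<times> I) (UT_grading A)"
    then have xc: "x \<in> carrier R" by (simp add: gr_radical_def)
    have "x i i \<in> M" if "i \<in> I" "maximal_right_ideal A M" for i M
    proof -
      have "x \<in> diag_ideal ((\<lambda>_. carrier A)(i := M))"
        using x gr_maximal_diag_ideal[OF that] by (simp add: gr_radical_def)
      then show ?thesis using that by (auto simp: diag_ideal_def)
    qed
    then show "x \<in> J" using xc by (simp add: diag_ideal_def mem_jacobson_radical_iff UT_entry_closed)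
  qed
  show "J \<subseteq> gr_radical R (I \<times> I) (UT_grading A)"
    by (auto simp: gr_radical_def diag_ideal_def mem_jacobson_radical_iff UT_entry_closed
        elim!: gr_maximal_imp_diag_ideal)
qed

section \<open>Semisimplicity of the quotient by the graded radical\<close>

lemma right_ideal_jacobson_radical: "right_ideal A (jacobson_radical A)"
  using ideal_jacobson_radical
  by (auto simp: right_ideal_def ideal_def ideal.I_r_closed[OF ideal_jacobson_radical])

lemma J_two_sided_ideal: "two_sided_ideal R J"
proof (intro two_sided_ideal.intro UT_nonunital_ring two_sided_ideal_axioms.intro)
  have "right_ideal R J"
    by (intro gr_right_ideal gr_diag_ideal right_ideal_jacobson_radical)
  then show "additive_subgroup J R" "\<And>x r. x \<in> J \<Longrightarrow> r \<in> carrier R \<Longrightarrow> x \<otimes>\<^bsub>R\<^esub> r \<in> J"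
    by (simp_all add: right_ideal_def)
  show "r \<otimes>\<^bsub>R\<^esub> x \<in> J" if "x \<in> J" "r \<in> carrier R" for x r
    using that ideal.I_l_closed[OF ideal_jacobson_radical]
    by (auto simp: diag_ideal_def diagonal_mult UT.m_closed UT_entry_closed)
qed

text \<open>The members of \<open>?LR\<close> are the \<open>diag_ideal W\<close> with all
  \<open>W i\<close> in \<open>?L\<close>, ordered componentwise. An atom of \<open>?L\<close> put
  at one place gives an atom of \<open>?LR\<close>, and a component of an atom of \<open>?LR\<close>
  that differs from the radical is an atom of \<open>?L\<close>. Passing from \<open>R\<close> down
  to \<open>A\<close> uses an index in \<open>I\<close>.\<close>

lemma gr_semisimple_UT_iff:
  assumes "I \<noteq> {}"
  shows "gr_semisimple (R Quot J) (I \<times> I) (quotient_grading R (UT_grading A) J) \<longleftrightarrow>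
    semisimple_ring (A Quot jacobson_radical A)"
proof -
  let ?rad = "jacobson_radical A"
  let ?L = "{V. right_ideal A V \<and> ?rad \<subseteq> V}" and ?LR = "{V. gr V \<and> J \<subseteq> V}"
  have rad_L: "?rad \<in> ?L" using right_ideal_jacobson_radical by simp
  have D_LR: "diag_ideal W \<in> ?LR" if "\<And>i. i \<in> I \<Longrightarrow> W i \<in> ?L" for W
    using that by (auto intro!: gr_diag_ideal) (auto simp: diag_ideal_def)
  have LR_D: "\<exists>W. V = diag_ideal W \<and> (\<forall>i\<in>I. W i \<in> ?L)" if V: "V \<in> ?LR" for V
  proof -
    have "gr V" "J \<subseteq> V" using V by auto
    from gr_superset_diag_ideal[OF right_ideal_jacobson_radical this]
    obtain W where "V = diag_ideal W" "\<And>i. i \<in> I \<Longrightarrow> right_ideal A (W i)" "\<And>i. i \<in> I \<Longrightarrow> ?rad \<subseteq> W i"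
      by blast
    then show ?thesis by blast
  qed
  have D_sub: "diag_ideal W \<subseteq> diag_ideal W' \<longleftrightarrow> (\<forall>i\<in>I. W i \<subseteq> W' i)"
    and D_eq: "diag_ideal W = diag_ideal W' \<longleftrightarrow> (\<forall>i\<in>I. W i = W' i)"
    if "\<And>i. i \<in> I \<Longrightarrow> W i \<in> ?L" "\<And>i. i \<in> I \<Longrightarrow> W' i \<in> ?L" for W W'
    using that by (auto intro!: diag_ideal_subset_iff diag_ideal_eq_iff)
  let ?at = "\<lambda>i S. (\<lambda>_. ?rad)(i := S)"
  have at_L: "?at i S k \<in> ?L" if "S \<in> ?L" for i k S
    using that rad_L by auto
  have atom_at: "diag_ideal (?at i S) \<in> atoms_over ?LR J" if i: "i \<in> I" and S: "S \<in> atoms_over ?L ?rad" for i S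
  proof -
    have SL: "S \<in> ?L" and S_ne: "S \<noteq> ?rad"
      and S_min: "\<And>V. V \<in> ?L \<Longrightarrow> V \<subseteq> S \<Longrightarrow> V = ?rad \<or> V = S"
      using S by (auto simp: atoms_over_def)
    have "diag_ideal (?at i S) \<noteq> J"
      using S_ne i D_eq[of "?at i S" "\<lambda>_. ?rad", OF at_L[OF SL] rad_L] by auto
    moreover have "V = J \<or> V = diag_ideal (?at i S)" if V: "V \<in> ?LR" "V \<subseteq> diag_ideal (?at i S)" for V
    proof -
      obtain W where W: "V = diag_ideal W" "\<And>k. k \<in> I \<Longrightarrow> W k \<in> ?L" using LR_D[OF V(1)] by blast
      have sub: "\<And>k. k \<in> I \<Longrightarrow> W k \<subseteq> ?at i S k"
        using V(2) D_sub[of W "?at i S", OF W(2) at_L[OF SL]] W(1) by auto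
      \<comment> \<open>At the other places the component is squeezed between the radical and
        itself, so only the one at \<open>i\<close> can vary.\<close>
      have other: "W k = ?rad" if "k \<in> I" "k \<noteq> i" for k
        using sub[OF that(1)] W(2)[OF that(1)] that(2) by auto
      have "W i = ?rad \<or> W i = S" using S_min[OF W(2)[OF i]] sub[OF i] by simp
      then show ?thesis
      proof
        assume "W i = ?rad"
        then have "W k = ?rad" if "k \<in> I" for k using other that by (cases "k = i") auto
        then have "V = J" unfolding W(1) using D_eq[of W "\<lambda>_. ?rad", OF W(2) rad_L] by blast
        then show ?thesis ..
      next
        assume "W i = S"
        then have "W k = ?at i S k" if "k \<in> I" for k using other that by (cases "k = i") auto
        then have "V = diag_ideal (?at i S)"
          unfolding W(1) using D_eq[of W "?at i S", OF W(2) at_L[OF SL]] by blast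
        then show ?thesis ..
      qed
    qed
    ultimately show ?thesis
      unfolding atoms_over_def using D_LR[of "?at i S", OF at_L[OF SL]] by blast
  qed
  have atom_component: "W k \<in> atoms_over ?L ?rad"
    if W: "\<And>i. i \<in> I \<Longrightarrow> W i \<in> ?L" "diag_ideal W \<in> atoms_over ?LR J"
      and k: "k \<in> I" "W k \<noteq> ?rad" for W k
  proof -
    have min: "V = J \<or> V = diag_ideal W" if "V \<in> ?LR" "V \<subseteq> diag_ideal W" for V
      using W(2) that by (auto simp: atoms_over_def)
    have "S = ?rad \<or> S = W k" if S: "S \<in> ?L" "S \<subseteq> W k" for S
    proof -
      \<comment> \<open>With \<open>S\<close> at \<open>k\<close> and the radical at all other
        places, the family lies below \<open>W\<close>, so minimality of the atom applies to
        it.\<close>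
      have "diag_ideal (?at k S) \<subseteq> diag_ideal W"
        using S(2) W(1) D_sub[of "?at k S" W, OF at_L[OF S(1)] W(1)] by auto
      from min[OF D_LR[of "?at k S", OF at_L[OF S(1)]] this]
      have "(\<forall>i\<in>I. ?at k S i = ?rad) \<or> (\<forall>i\<in>I. ?at k S i = W i)"
        using D_eq[of "?at k S" "\<lambda>_. ?rad", OF at_L[OF S(1)] rad_L]
          D_eq[of "?at k S" W, OF at_L[OF S(1)] W(1)] by blast
      then show ?thesis using k(1) by auto
    qed
    then show ?thesis using W(1)[OF k(1)] k(2) by (auto simp: atoms_over_def)
  qed
  have "atoms_span ?LR J (carrier R) \<longleftrightarrow> atoms_span ?L ?rad (carrier A)"
  proof
    assume span: "atoms_span ?L ?rad (carrier A)"
    show "atoms_span ?LR J (carrier R)"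
      unfolding atoms_span_def
    proof (intro ballI impI)
      fix T assume T: "T \<in> ?LR" "\<forall>S\<in>atoms_over ?LR J. S \<subseteq> T"
      obtain W where W: "T = diag_ideal W" "\<And>k. k \<in> I \<Longrightarrow> W k \<in> ?L" using LR_D[OF T(1)] by blast
      \<comment> \<open>Atoms of \<open>?L\<close> placed at \<open>i\<close> give atoms of
        \<open>?LR\<close> below \<open>T\<close>, so \<open>W i\<close> lies above all atoms of
        \<open>?L\<close>.\<close>
      have "W i = carrier A" if i: "i \<in> I" for i
      proof -
        have "S \<subseteq> W i" if S: "S \<in> atoms_over ?L ?rad" for S
        proof -
          have SL: "S \<in> ?L" using S by (auto simp: atoms_over_def)
          have "diag_ideal (?at i S) \<subseteq> diag_ideal W" using T(2) atom_at[OF i S] W(1) by blast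
          then have "?at i S i \<subseteq> W i"
            using D_sub[of "?at i S" W, OF at_L[OF SL] W(2)] i by blast
          then show ?thesis by simp
        qed
        then show ?thesis using span W(2)[OF i] by (auto simp: atoms_span_def)
      qed
      then show "T = carrier R" by (auto simp: W(1) diag_ideal_def UT_entry_closed)
    qed
  next
    assume span: "atoms_span ?LR J (carrier R)"
    obtain i where i: "i \<in> I" using assms by blast
    show "atoms_span ?L ?rad (carrier A)"
      unfolding atoms_span_def
    proof (intro ballI impI)
      fix T assume T: "T \<in> ?L" "\<forall>S\<in>atoms_over ?L ?rad. S \<subseteq> T"
      \<comment> \<open>Each component of an atom of \<open>?LR\<close> is the radical or an atom of
        \<open>?L\<close>, and \<open>T\<close> contains both.\<close>
      have "S \<subseteq> diag_ideal (\<lambda>_. T)" if S: "S \<in> atoms_over ?LR J" for S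
      proof -
        have "S \<in> ?LR" using S by (auto simp: atoms_over_def)
        then obtain W where W: "S = diag_ideal W" "\<And>k. k \<in> I \<Longrightarrow> W k \<in> ?L" using LR_D by blast
        have "W k \<subseteq> T" if k: "k \<in> I" for k
        proof (cases "W k = ?rad")
          case False
          have "diag_ideal W \<in> atoms_over ?LR J" using S W(1) by simp
          from atom_component[OF W(2) this k False] T(2) show ?thesis by blast
        qed (use T(1) in auto)
        then show ?thesis by (auto simp: W(1) diag_ideal_def)
      qed
      with span D_LR[of "\<lambda>_. T", OF T(1)] have "diag_ideal (\<lambda>_. T) = carrier R"
        by (simp add: atoms_span_def)
      then have "\<forall>i\<in>I. T = carrier A"
        unfolding diag_ideal_carrier[symmetric] using T(1) right_ideal_carrier
        by (subst (asm) diag_ideal_eq_iff) auto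
      then show "T = carrier A" using i by blast
    qed
  qed
  then show ?thesis
    by (simp add: gr_semisimple_Quot_iff[OF J_two_sided_ideal] semisimple_Quot_iff[OF ideal_jacobson_radical])
qed

subsection \<open>Objectwise nilpotency\<close>

lemma zero_mem_J: "\<zero>\<^bsub>R\<^esub> \<in> J"
  using additive_subgroup.zero_closed[OF two_sided_ideal.J_subgroup[OF J_two_sided_ideal]] .

lemma J_subset: "J \<subseteq> carrier R"
  by (auto simp: diag_ideal_def)

lemma ideal_power_J_subset: "ideal_power R J n \<subseteq> carrier R"
proof (induction n)
  case (Suc n)
  have "x \<in> carrier R" if "x \<in> ideal_prod R (ideal_power R J n) J" for x
    using that by induction (use Suc J_subset in \<open>auto intro!: UT.m_closed\<close>)
  then show ?case using J_subset by (cases n) auto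
qed simp

lemma zero_mem_ideal_power_J: "\<zero>\<^bsub>R\<^esub> \<in> ideal_power R J n"
proof (induction n)
  case (Suc n)
  \<comment> \<open>\<open>ideal_prod\<close> is generated by products and sums, so zero enters as a
    product of zeros.\<close>
  have "\<zero>\<^bsub>R\<^esub> \<otimes>\<^bsub>R\<^esub> \<zero>\<^bsub>R\<^esub> \<in> ideal_prod R (ideal_power R J n) J"
    using Suc zero_mem_J by (intro ideal_prod.prod)
  then show ?case using zero_mem_J by (cases n) (simp_all add: UT.r_null)
qed simp

lemma ideal_power_J_mult:
  "x \<in> ideal_power R J n \<Longrightarrow> y \<in> J \<Longrightarrow> x \<otimes>\<^bsub>R\<^esub> y \<in> ideal_power R J (Suc n)"
  using two_sided_ideal.J_left[OF J_two_sided_ideal] by (cases n) (auto intro: ideal_prod.prod)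

text \<open>Multiplying by the unit on the left keeps exactly row \<open>i\<close>. The zero matrix
  in the power ensures that the coset is not empty.\<close>

lemma unit_l_coset_ideal_power_iff:
  assumes "i \<in> I"
  shows "UT_unit A i <#\<^bsub>R\<^esub> ideal_power R J n = {\<zero>\<^bsub>R\<^esub>} \<longleftrightarrow> (\<forall>x\<in>ideal_power R J n. \<forall>j. x i j = \<zero>)"
proof -
  have "UT_unit A i \<otimes>\<^bsub>R\<^esub> x = \<zero>\<^bsub>R\<^esub> \<longleftrightarrow> (\<forall>j. x i j = \<zero>)" if "x \<in> ideal_power R J n" for x
    using assms that ideal_power_J_subset by (auto simp: UT_unit_mult_left zero_UT fun_eq_iff subset_iff)
  then show ?thesis
    using zero_mem_ideal_power_J[of n] by (auto simp: l_coset_def)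
qed

lemma unit_r_coset_ideal_power_iff:
  assumes "i \<in> I"
  shows "ideal_power R J n #>\<^bsub>R\<^esub> UT_unit A i = {\<zero>\<^bsub>R\<^esub>} \<longleftrightarrow> (\<forall>x\<in>ideal_power R J n. \<forall>j. x j i = \<zero>)"
proof -
  have "x \<otimes>\<^bsub>R\<^esub> UT_unit A i = \<zero>\<^bsub>R\<^esub> \<longleftrightarrow> (\<forall>j. x j i = \<zero>)" if "x \<in> ideal_power R J n" for x
    using assms that ideal_power_J_subset by (auto simp: UT_unit_mult_right zero_UT fun_eq_iff subset_iff)
  then show ?thesis
    using zero_mem_ideal_power_J[of n] by (auto simp: r_coset_def)
qed

text \<open>The map taking \<open>a\<close> to \<open>E a i i\<close> respects sums and products and
  sends the radical of \<open>A\<close> into \<open>J\<close>, hence powers into powers.\<close>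

lemma single_entry_mem_ideal_power:
  assumes i: "i \<in> I" and a: "a \<in> ideal_power A (jacobson_radical A) n"
  shows "E a i i \<in> ideal_power R J n"
proof -
  let ?rad = "jacobson_radical A"
  have rad: "E b i i \<in> J" if "b \<in> ?rad" for b
    using that i nonunital_A.right_idealD(1,2)[OF right_ideal_jacobson_radical]
    by (auto simp: diag_ideal_def single_entry_apply single_entry_closed)
  have rad_c: "ideal_power A ?rad n \<subseteq> carrier A" for n
    by (rule subsetI) (rule ideal.Icarr[OF ideal_ideal_power[OF ideal_jacobson_radical]])
  show ?thesis using a
  proof (induction n arbitrary: a)
    case 0
    then show ?case using i by (simp add: single_entry_closed)
  next
    case (Suc n)
    show ?case
    proof (cases n)
      case 0
      then show ?thesis using Suc.prems rad by simp
    next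
      case (Suc m)
      \<comment> \<open>Membership in \<open>A\<close> is carried along in the induction, since
        adding single entries requires it.\<close>
      have "b \<in> carrier A \<and> E b i i \<in> ideal_prod R (ideal_power R J n) J"
        if "b \<in> ideal_prod A (ideal_power A ?rad n) ?rad" for b
        using that
      proof induction
        case (prod b c)
        then have "b \<in> carrier A" "c \<in> carrier A"
          using rad_c by (auto simp: mem_jacobson_radical_iff)
        moreover have "E b i i \<otimes>\<^bsub>R\<^esub> E c i i \<in> ideal_prod R (ideal_power R J n) J"
          using prod Suc.IH rad by (intro ideal_prod.prod)
        ultimately show ?case using i by (simp add: single_entry_mult)
      next
        case (sum b c)
        then show ?case
          using ideal_prod.sum[of "E b i i" R _ J "E c i i"] by (simp add: single_entry_add)
      qed
      then show ?thesis using Suc.prems Suc by simp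
    qed
  qed
qed

text \<open>Each strict step gives some \<open>E \<one> j l\<close> with zero diagonal, hence in
  \<open>J\<close>, and the product along the chain telescopes. Induction from the end of the list
  fits \<open>ideal_power\<close>, which multiplies on the right.\<close>

lemma chain_mem_ideal_power:
  assumes i: "i \<in> I" and ks: "set ks \<subseteq> I" "sorted_wrt (<) (i # ks)" "ks \<noteq> []"
  shows "E \<one> i (last ks) \<in> ideal_power R J (length ks)"
  using ks
proof (induction ks rule: rev_induct)
  case (snoc k ks)
  have step: "E \<one> j l \<in> J" if "j \<in> I" "l \<in> I" "j < l" for j l
    using that nonunital_A.right_idealD(2)[OF right_ideal_jacobson_radical]
    by (auto simp: diag_ideal_def single_entry_closed single_entry_apply less_imp_le)
  show ?case
  proof (cases "ks = []")
    case True
    then show ?thesis using snoc.prems step[of i k] i by simp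
  next
    case False
    let ?j = "last ks"
    have j: "?j \<in> set ks" using False by simp
    then have lt: "i < ?j" "?j < k" and I: "?j \<in> I" "k \<in> I"
      using snoc.prems by (auto simp: sorted_wrt_append)
    have "E \<one> i ?j \<in> ideal_power R J (length ks)"
      using snoc False by (auto simp: sorted_wrt_append)
    from ideal_power_J_mult[OF this step[OF I lt(2)]] show ?thesis
      using i I lt by (simp add: single_entry_mult less_imp_le)
  qed
qed simp

text \<open>Read as \<open>i \<le> k_1 < ... < k_q < j\<close>: the list holds the starting points
  of \<open>q\<close> strict steps, so that a further step can be appended on the right. For
  \<open>q = 0\<close> the condition is vacuous.\<close>

definition chain_between :: "'i \<Rightarrow> 'i \<Rightarrow> nat \<Rightarrow> bool" where
  "chain_between i j q \<longleftrightarrow>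
     (\<exists>ks. set ks \<subseteq> I \<inter> {i..} \<and> length ks = q \<and> sorted_wrt (<) (ks @ [j]))"

lemma chain_between_snoc:
  assumes "chain_between i k q" "k \<in> I" "i \<le> k" "k < j"
  shows "chain_between i j (Suc q)"
proof -
  obtain ks where ks: "set ks \<subseteq> I \<inter> {i..}" "length ks = q" "sorted_wrt (<) (ks @ [k])"
    using assms by (auto simp: chain_between_def)
  then have "set (ks @ [k]) \<subseteq> I \<inter> {i..} \<and> length (ks @ [k]) = Suc q \<and> sorted_wrt (<) ((ks @ [k]) @ [j])"
    using assms by (auto simp: sorted_wrt_append intro: less_trans)
  then show ?thesis unfolding chain_between_def by blast
qed

text \<open>Consider the last factor of a product. A term with \<open>k = j\<close> contributes an
  element of \<open>rad A\<close> and raises the exponent by one; a term with \<open>k < j\<close>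
  uses up a strict step, leaving one fewer for the way from \<open>i\<close> to \<open>k\<close>.
  Subtraction is truncated: for \<open>q > n\<close> the claim is only that the entry lies in
  \<open>A\<close>.\<close>

lemma ideal_power_J_entry:
  assumes "x \<in> ideal_power R J (Suc n)" "\<not> chain_between i j (Suc q)"
  shows "x i j \<in> ideal_power A (jacobson_radical A) (Suc n - q)"
  using assms
proof (induction n arbitrary: x i j q)
  case 0
  let ?rad = "jacobson_radical A"
  have x: "x \<in> J" "x \<in> carrier R" using 0 by (auto simp: diag_ideal_def)
  show ?case
  proof (cases q)
    case (Suc p)
    then show ?thesis using x by (simp add: UT_entry_closed)
  next
    case q: 0
    have "x i j \<in> ?rad"
    proof (cases "i \<in> I \<and> j \<in> I \<and> i \<le> j")
      case False
      then show ?thesis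
        using UT_entry_zero[OF x(2)] nonunital_A.right_idealD(2)[OF right_ideal_jacobson_radical] by auto
    next
      case True
      \<comment> \<open>No strict step is allowed here, and the chain \<open>[i]\<close> would be
        one if \<open>i < j\<close>; so only diagonal entries remain.\<close>
      have "chain_between i j 1" if "i < j"
        unfolding chain_between_def using True that by (intro exI[of _ "[i]"]) simp
      then have "i = j" using 0 q True by (auto simp: order_le_less)
      then show ?thesis using x True by (simp add: diag_ideal_def)
    qed
    then show ?thesis using q by simp
  qed
next
  case (Suc n)
  let ?rad = "jacobson_radical A"
  let ?P = "\<lambda>m. ideal_power A ?rad m"
  have P: "ideal (?P m) A" for m by (rule ideal_ideal_power[OF ideal_jacobson_radical])
  interpret P: ideal "?P (Suc (Suc n) - q)" A by (rule P)
  have "x \<in> ideal_prod R (ideal_power R J (Suc n)) J" using Suc.prems(1) by simp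
  then show ?case
  proof induction
    case (prod y z)
    have y: "y \<in> carrier R" using prod(1) ideal_power_J_subset by blast
    have z: "z \<in> carrier R" using prod(2) J_subset by blast
    obtain K where K: "finite K" "\<And>i j. y i j \<noteq> \<zero> \<Longrightarrow> i \<in> K \<and> j \<in> K" using UT_support[OF y] by blast
    have "y i k \<otimes> z k j \<in> ?P (Suc (Suc n) - q)" for k
    proof (cases "y i k \<otimes> z k j = \<zero>")
      case False
      have "y i k \<noteq> \<zero>" "z k j \<noteq> \<zero>"
        using mult_nonzeroD[OF False] y z by (auto simp: UT_entry_closed)
      then have ik: "i \<in> I" "i \<le> k" "k \<in> I" "k \<le> j" using y z by (auto simp: carrier_UT)
      show ?thesis
      proof (cases "k = j")
        case True
        have "y i k \<in> ?P (Suc n - q)" using Suc.IH[OF prod(1)] Suc.prems(2) True by blast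
        moreover have "z k j \<in> ?rad" using prod(2) True ik by (auto simp: diag_ideal_def)
        ultimately have *: "y i k \<otimes> z k j \<in> ?P (Suc (Suc n - q))"
          by (rule ideal_power_mult[OF ideal_jacobson_radical])
        \<comment> \<open>If \<open>q\<close> exceeds \<open>Suc n\<close>, the truncated exponent
          is zero and the target ideal is all of \<open>A\<close>.\<close>
        show ?thesis
        proof (cases "q \<le> Suc n")
          case True
          then show ?thesis using * by (simp add: Suc_diff_le)
        next
          case False
          then show ?thesis using y z by (simp add: UT_entry_closed)
        qed
      next
        case False
        then have kj: "k < j" using ik by simp
        \<comment> \<open>The index \<open>k\<close> itself starts a strict step to
          \<open>j\<close>, so a bound of zero strict steps is impossible.\<close>
        have "chain_between i k 0" by (simp add: chain_between_def)
        from chain_between_snoc[OF this ik(3,2) kj] have "q \<noteq> 0" using Suc.prems(2) by (cases q) auto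
        then obtain p where p: "q = Suc p" by (cases q) auto
        have "\<not> chain_between i k (Suc p)"
          using chain_between_snoc[OF _ ik(3,2) kj] Suc.prems(2) p by blast
        from Suc.IH[OF prod(1) this] have "y i k \<in> ?P (Suc (Suc n) - q)" using p by simp
        then show ?thesis using z by (intro P.I_r_closed) (auto simp: UT_entry_closed)
      qed
    qed simp
    then have "(\<Oplus>k\<in>K. y i k \<otimes> z k j) \<in> ?P (Suc (Suc n) - q)"
      by (intro finsum_in_subgroup P.additive_subgroup_axioms)
    then show ?case using mult_UT_left_support[OF y z K(1), of i j] K(2) by metis
  next
    case (sum y z)
    then show ?case by (simp add: add_UT)
  qed
qed

section \<open>Objectwise nilpotency and bounds on chains\<close>

lemma objectwise_nilpotent_imp_chain_bound:
  assumes nontrivial: "\<one> \<noteq> \<zero>" and nil: "objectwise_nilpotent R I (UT_unit A) J" and i: "i \<in> I"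
  shows "\<exists>n. \<not> (\<exists>ks. set ks \<subseteq> I \<and> length ks = n \<and> sorted_wrt (<) (i # ks)) \<and>
             \<not> (\<exists>ks. set ks \<subseteq> I \<and> length ks = n \<and> sorted_wrt (<) (ks @ [i]))"
proof -
  obtain n m where n: "n \<ge> 1" "\<And>x j. x \<in> ideal_power R J n \<Longrightarrow> x i j = \<zero>"
    and m: "m \<ge> 1" "\<And>x j. x \<in> ideal_power R J m \<Longrightarrow> x j i = \<zero>"
    using nil i unfolding objectwise_nilpotent_def
    by (auto simp: unit_l_coset_ideal_power_iff unit_r_coset_ideal_power_iff)
  \<comment> \<open>Such a chain would put the nonzero entry \<open>\<one>\<close> into row
    \<open>i\<close> of an element of the power.\<close>
  have up: False if ks: "set ks \<subseteq> I" "length ks = n" "sorted_wrt (<) (i # ks)" for ks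
  proof -
    have "E \<one> i (last ks) \<in> ideal_power R J n"
      using chain_mem_ideal_power[OF i ks(1,3)] ks(2) n(1) by fastforce
    from n(2)[OF this, of "last ks"] show False using nontrivial by (simp add: single_entry_apply)
  qed
  have down: False if ks: "set ks \<subseteq> I" "length ks = m" "sorted_wrt (<) (ks @ [i])" for ks
  proof -
    \<comment> \<open>The chain is read from its least element \<open>h\<close>: the rest followed
      by \<open>i\<close> is a chain of the same length above \<open>h\<close>.\<close>
    obtain h t where ht: "ks = h # t" using ks(2) m(1) by (cases ks) auto
    have "E \<one> h (last (t @ [i])) \<in> ideal_power R J (length (t @ [i]))"
      using ks i ht by (intro chain_mem_ideal_power) auto
    then have "E \<one> h i \<in> ideal_power R J m" using ks(2) ht by simp
    from m(2)[OF this, of h] show False using nontrivial by (simp add: single_entry_apply)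
  qed
  \<comment> \<open>One length has to serve both directions; a chain that is too long is shortened
    at the end away from \<open>i\<close>.\<close>
  have "\<not> (\<exists>ks. set ks \<subseteq> I \<and> length ks = max n m \<and> sorted_wrt (<) (i # ks))"
  proof
    assume "\<exists>ks. set ks \<subseteq> I \<and> length ks = max n m \<and> sorted_wrt (<) (i # ks)"
    then obtain ks where ks: "set ks \<subseteq> I" "length ks = max n m" "sorted_wrt (<) (i # ks)" by blast
    have "sorted_wrt (<) (i # take n ks)"
      using sorted_wrt_take[OF ks(3), of "Suc n"] by simp
    then show False using up[of "take n ks"] ks set_take_subset[of n ks] by auto
  qed
  moreover have "\<not> (\<exists>ks. set ks \<subseteq> I \<and> length ks = max n m \<and> sorted_wrt (<) (ks @ [i]))"
  proof
    assume "\<exists>ks. set ks \<subseteq> I \<and> length ks = max n m \<and> sorted_wrt (<) (ks @ [i])"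
    then obtain ks where ks: "set ks \<subseteq> I" "length ks = max n m" "sorted_wrt (<) (ks @ [i])" by blast
    have "sorted_wrt (<) (drop (max n m - m) ks @ [i])"
      using sorted_wrt_drop[OF ks(3), of "max n m - m"] ks(2) by simp
    then show False
      using down[of "drop (max n m - m) ks"] ks set_drop_subset[of "max n m - m" ks] by auto
  qed
  ultimately show ?thesis by blast
qed

text \<open>A single row is enough, since each power of \<open>rad A\<close> embeds into the same
  power of \<open>J\<close> at position \<open>(i, i)\<close>.\<close>

lemma objectwise_nilpotent_imp_radical_nilpotent:
  assumes nil: "objectwise_nilpotent R I (UT_unit A) J" and "I \<noteq> {}"
  shows "\<exists>n\<ge>1. ideal_power A (jacobson_radical A) n = {\<zero>}"
proof -
  obtain i where i: "i \<in> I" using assms by blast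
  obtain n where n: "n \<ge> 1" "\<And>x j. x \<in> ideal_power R J n \<Longrightarrow> x i j = \<zero>"
    using nil i unfolding objectwise_nilpotent_def by (auto simp: unit_l_coset_ideal_power_iff)
  have "a = \<zero>" if "a \<in> ideal_power A (jacobson_radical A) n" for a
    using n(2)[OF single_entry_mem_ideal_power[OF i that], of i] by (simp add: single_entry_apply)
  moreover have "\<zero> \<in> ideal_power A (jacobson_radical A) n"
    using ideal_ideal_power[OF ideal_jacobson_radical, of n]
    by (simp add: ideal_def additive_subgroup.zero_closed)
  ultimately show ?thesis using n(1) by blast
qed

text \<open>The exponent \<open>m + N\<close> works for rows and columns alike: with at most
  \<open>N\<close> strict steps among the \<open>m + N\<close> factors, at least \<open>m\<close> of
  them come from \<open>rad A\<close>.\<close>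

lemma objectwise_nilpotentI:
  assumes m: "m \<ge> 1" "ideal_power A (jacobson_radical A) m = {\<zero>}"
    and bound: "\<And>i. i \<in> I \<Longrightarrow> \<exists>n. \<not> (\<exists>ks. set ks \<subseteq> I \<and> length ks = n \<and> sorted_wrt (<) (i # ks)) \<and>
             \<not> (\<exists>ks. set ks \<subseteq> I \<and> length ks = n \<and> sorted_wrt (<) (ks @ [i]))"
  shows "objectwise_nilpotent R I (UT_unit A) J"
  unfolding objectwise_nilpotent_def
proof
  fix i assume i: "i \<in> I"
  obtain N where N: "\<And>ks. set ks \<subseteq> I \<Longrightarrow> length ks = N \<Longrightarrow> \<not> sorted_wrt (<) (i # ks)"
    "\<And>ks. set ks \<subseteq> I \<Longrightarrow> length ks = N \<Longrightarrow> \<not> sorted_wrt (<) (ks @ [i])"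
    using bound[OF i] by blast
  \<comment> \<open>Here \<open>ideal_power_J_entry\<close> gives membership in the power of
    \<open>rad A\<close> with exponent \<open>m + N - N = m\<close>, which is zero.\<close>
  have entry: "x k l = \<zero>" if "x \<in> ideal_power R J (m + N)" "\<not> chain_between k l (Suc N)" for x k l
    using ideal_power_J_entry[of x "m + N - 1" k l N] that m by simp
  have row: "x i j = \<zero>" if x: "x \<in> ideal_power R J (m + N)" for x j
  proof (cases "j \<in> I")
    case False
    then show ?thesis using UT_entry_zero x ideal_power_J_subset by blast
  next
    case True
    have "\<not> chain_between i j (Suc N)"
    proof
      assume "chain_between i j (Suc N)"
      then obtain ks where ks: "set ks \<subseteq> I \<inter> {i..}" "length ks = Suc N" "sorted_wrt (<) (ks @ [j])"
        by (auto simp: chain_between_def)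
      then obtain h t where ht: "ks = h # t" by (cases ks) auto
      \<comment> \<open>Of \<open>h\<close> only \<open>i \<le> h\<close> is known, so
        \<open>h\<close> is replaced by \<open>i\<close>, which leaves \<open>N\<close> elements
        above \<open>i\<close>.\<close>
      have "sorted_wrt (<) (i # t)" using ks ht by (auto simp: sorted_wrt_append intro: le_less_trans)
      with N(1)[of t] ks ht show False by auto
    qed
    then show ?thesis using entry x by blast
  qed
  have column: "x j i = \<zero>" if x: "x \<in> ideal_power R J (m + N)" for x j
  proof -
    have "\<not> chain_between j i (Suc N)"
    proof
      assume "chain_between j i (Suc N)"
      then obtain ks where ks: "set ks \<subseteq> I \<inter> {j..}" "length ks = Suc N" "sorted_wrt (<) (ks @ [i])"
        by (auto simp: chain_between_def)
      then obtain h t where ht: "ks = h # t" by (cases ks) auto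
      with N(2)[of t] ks show False by auto
    qed
    then show ?thesis using entry x by blast
  qed
  have "1 \<le> m + N" using m by simp
  then show "(\<exists>n\<ge>1. UT_unit A i <#\<^bsub>R\<^esub> ideal_power R J n = {\<zero>\<^bsub>R\<^esub>}) \<and>
      (\<exists>n\<ge>1. ideal_power R J n #>\<^bsub>R\<^esub> UT_unit A i = {\<zero>\<^bsub>R\<^esub>})"
    using row column
    unfolding unit_l_coset_ideal_power_iff[OF i] unit_r_coset_ideal_power_iff[OF i] by blast
qed

end

section \<open>The equivalence, from semisimplicity and nilpotency separately\<close>

theorem corollary6p4:
  fixes A :: "('a, 'm) ring_scheme" and I :: "'i::order set"
  assumes "ring A" and "\<one>\<^bsub>A\<^esub> \<noteq> \<zero>\<^bsub>A\<^esub>"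
    and "I \<noteq> {}"
  shows "gr_semiprimary_graded_ring (UT I A) I (UT_grading A) (UT_unit A) \<longleftrightarrow>
         semiprimary_ring A \<and>
         (\<forall>i\<in>I. \<exists>n::nat.
            \<not> (\<exists>ks. set ks \<subseteq> I \<and> length ks = n \<and> sorted_wrt (<) (i # ks)) \<and>
            \<not> (\<exists>ks. set ks \<subseteq> I \<and> length ks = n \<and> sorted_wrt (<) (ks @ [i])))"
proof -
  interpret UT_ring A I using assms(1) by (rule UT_ring.intro)
  \<comment> \<open>Semisimplicity of the two quotients already agrees, so it remains to split
    objectwise nilpotency of \<open>J\<close> into nilpotency of the radical of \<open>A\<close> and
    the bounds on chains.\<close>
  have "gr_semiprimary_graded_ring R I (UT_grading A) (UT_unit A) \<longleftrightarrow>
      semisimple_ring (A Quot jacobson_radical A) \<and> objectwise_nilpotent R I (UT_unit A) J"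
    by (simp add: gr_semiprimary_graded_ring_def UT_pair_graded_ring gr_radical_UT
        gr_semisimple_UT_iff[OF assms(3)])
  also have "\<dots> \<longleftrightarrow> semiprimary_ring A \<and>
         (\<forall>i\<in>I. \<exists>n::nat.
            \<not> (\<exists>ks. set ks \<subseteq> I \<and> length ks = n \<and> sorted_wrt (<) (i # ks)) \<and>
            \<not> (\<exists>ks. set ks \<subseteq> I \<and> length ks = n \<and> sorted_wrt (<) (ks @ [i])))"
    (is "?ss \<and> ?nil \<longleftrightarrow> _ \<and> ?chains")
  proof (intro iffI conjI)
    assume "?ss \<and> ?nil"
    then have ss: ?ss and nil: ?nil by auto
    show "semiprimary_ring A"
      unfolding semiprimary_ring_def
      using ss objectwise_nilpotent_imp_radical_nilpotent[OF nil assms(3)] by (rule conjI)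
    show ?chains
      by (rule ballI) (rule objectwise_nilpotent_imp_chain_bound[OF assms(2) nil])
  next
    assume *: "semiprimary_ring A \<and> ?chains"
    then show ?ss by (simp add: semiprimary_ring_def)
    obtain m where "m \<ge> 1" "ideal_power A (jacobson_radical A) m = {\<zero>\<^bsub>A\<^esub>}"
      using * by (auto simp: semiprimary_ring_def)
    then show ?nil using * by (intro objectwise_nilpotentI) (assumption, assumption, rule bspec[OF conjunct2])
  qed
  finally show ?thesis .
qed

end
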